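(* Let $(V_1,\mathbf{F}_1)$ and $(V_2,\mathbf{F}_2)$ be two Minkowski spaces of dimension $n>2$. Let $f:V_1\rightarrow V_2$ be a norm preserving map (i.e. $\mathbf{F}_2(f(v))=\mathbf{F}_1(v)$ for all $v\in V_1$) which restricts to a diffeomorphism $(V_1)_0\to (V_2)_0$, where $(V_i)_0:=V_i\setminus\{0\}$, and satisfies $$f(tv)=tf(v),\qquad \forall v\in V_1,\ \forall t>0.$$ Let $\hat g_i$ and $\eta_i$ denote the conformal fundamental tensor and the Cartan form of $(V_i,\mathbf{F}_i)$, $i=1,2$. Then $\hat{g}_1=f^*\hat{g}_2$ and $\eta_1=f^*\eta_2$ (on $(V_1)_0$) if and only if there exists a nondegenerate linear homomorphism (i.e. a linear isomorphism) $L:V_1\to V_2$ such that $f=L$ and $$\mathbf{F}_1=\mathbf{F}_2\circ L.$$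
   Context: A Minkowski space $(V,\mathbf{F})$ is an $n$-dimensional real vector space $V$ (with its standard smooth structure and its standard flat affine connection $\bar\nabla$) together with a function $\mathbf{F}:V\to[0,+\infty)$ such that: (i) $\mathbf{F}$ is continuous on $V$ and smooth on $V_0:=V\setminus\{0\}$; (ii) $\mathbf{F}(\lambda v)=\lambda\mathbf{F}(v)$ for all $v\in V$, $\lambda>0$; (iii) the symmetric tensor $\bar g:=\bar\nabla d[\tfrac12\mathbf{F}^2]$ is positive definite everywhere on $V_0$. On $V_0$ one defines $\hat g=\frac{1}{\mathbf{F}^2}\bar g$. The Cartan form is $\eta=d\log|\mathcal{G}|$, where $|\mathcal{G}|=\left|\frac{\omega(\bar g)}{\omega}\right|$ is the Radon–Nikodym derivative of the Riemannian measure of $\bar g$ with respect to a translation invariant volume form $\omega=\mathbf{b}_1^*\wedge\cdots\wedge\mathbf{b}_n^*$ ($\mathbf{b}_i^*$ the dual basis of a basis of $V$); in the corresponding linear coordinates $y^i$, $|\mathcal{G}|=\sqrt{\det(\frac12[\mathbf{F}^2]_{y^iy^j})}$. The form $\eta$ does not depend on the choice of basis. *)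

theory Defs
  imports "HOL-Analysis.Analysis"
begin

text \<open>
  A finite-dimensional real vector space is rendered by a type of class
  \<open>euclidean_space\<close>. The inner product of the class enters only through the
  topology and the notion of differentiability, which are the standard ones of the vector space.
\<close>

abbreviation punctured :: "'a::euclidean_space set" where
  "punctured \<equiv> - {0}"

text \<open>The following is meant for open sets only, because the derivatives are taken \<open>at x\<close>.\<close>

primrec Ck_on :: "nat \<Rightarrow> 'a::euclidean_space set \<Rightarrow> ('a \<Rightarrow> 'b::euclidean_space) \<Rightarrow> bool" where
  "Ck_on 0 S f \<longleftrightarrow> continuous_on S f"
| "Ck_on (Suc k) S f \<longleftrightarrow> (\<forall>x\<in>S. f differentiable at x) \<and>
     (\<forall>v. Ck_on k S (\<lambda>x. frechet_derivative f (at x) v))"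

definition smooth_on :: "'a::euclidean_space set \<Rightarrow> ('a \<Rightarrow> 'b::euclidean_space) \<Rightarrow> bool" where
  "smooth_on S f \<longleftrightarrow> (\<forall>k. Ck_on k S f)"

definition diffeomorphism_between ::
    "'a::euclidean_space set \<Rightarrow> 'b::euclidean_space set \<Rightarrow> ('a \<Rightarrow> 'b) \<Rightarrow> bool" where
  "diffeomorphism_between S T f \<longleftrightarrow> (\<exists>g. homeomorphism S T f g \<and> smooth_on S f \<and> smooth_on T g)"

text \<open>
  For the flat connection, \<open>(\<nabla>dh)(u, v) = u(dh(v))\<close> when the vector field \<open>v\<close> is constant.
\<close>

definition flat_hessian :: "('a::euclidean_space \<Rightarrow> real) \<Rightarrow> 'a \<Rightarrow> 'a \<Rightarrow> 'a \<Rightarrow> real" where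
  "flat_hessian h x u v = frechet_derivative (\<lambda>y. frechet_derivative h (at y) v) (at x) u"

definition fundamental_tensor :: "('a::euclidean_space \<Rightarrow> real) \<Rightarrow> 'a \<Rightarrow> 'a \<Rightarrow> 'a \<Rightarrow> real" where
  "fundamental_tensor F = flat_hessian (\<lambda>z. (F z)\<^sup>2 / 2)"

definition minkowski_space :: "('a::euclidean_space \<Rightarrow> real) \<Rightarrow> bool" where
  "minkowski_space F \<longleftrightarrow>
     (\<forall>v. 0 \<le> F v) \<and>
     continuous_on UNIV F \<and> smooth_on punctured F \<and>
     (\<forall>v. \<forall>c>0. F (c *\<^sub>R v) = c * F v) \<and>
     (\<forall>x\<in>punctured. \<forall>u. u \<noteq> 0 \<longrightarrow> 0 < fundamental_tensor F x u u)"

definition conformal_tensor :: "('a::euclidean_space \<Rightarrow> real) \<Rightarrow> 'a \<Rightarrow> 'a \<Rightarrow> 'a \<Rightarrow> real" where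
  "conformal_tensor F x u v = fundamental_tensor F x u v / (F x)\<^sup>2"

definition vector_basis :: "('n::finite \<Rightarrow> 'a::euclidean_space) \<Rightarrow> bool" where
  "vector_basis b \<longleftrightarrow> inj b \<and> independent (range b) \<and> span (range b) = UNIV"

text \<open>
  The density of the Riemannian measure of the fundamental tensor with respect to the
  translation invariant volume form \<open>b\<^sub>1\<^sup>* \<and> \<dots> \<and> b\<^sub>n\<^sup>*\<close>: in the linear coordinates \<open>y\<^sup>i\<close> of
  the basis \<open>b\<close>, the matrix below is that of the second partial derivatives of \<open>F\<^sup>2 / 2\<close>.
\<close>

definition volume_ratio ::
    "('n::finite \<Rightarrow> 'a::euclidean_space) \<Rightarrow> ('a \<Rightarrow> real) \<Rightarrow> 'a \<Rightarrow> real" where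
  "volume_ratio b F x = sqrt (det ((\<chi> i j. fundamental_tensor F x (b i) (b j)) :: real^'n^'n))"

text \<open>
  On a Minkowski space the Cartan form is the same for all bases \<open>b\<close>, since a change of basis
  multiplies the volume ratio by a positive constant.
\<close>

definition cartan_form ::
    "('n::finite \<Rightarrow> 'a::euclidean_space) \<Rightarrow> ('a \<Rightarrow> real) \<Rightarrow> 'a \<Rightarrow> 'a \<Rightarrow> real" where
  "cartan_form b F x = frechet_derivative (\<lambda>y. ln (volume_ratio b F y)) (at x)"

definition pullback_form ::
    "('a::euclidean_space \<Rightarrow> 'b::euclidean_space) \<Rightarrow> ('b \<Rightarrow> 'b \<Rightarrow> real) \<Rightarrow> 'a \<Rightarrow> 'a \<Rightarrow> real" where
  "pullback_form f \<alpha> x u = \<alpha> (f x) (frechet_derivative f (at x) u)"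

definition pullback_tensor ::
    "('a::euclidean_space \<Rightarrow> 'b::euclidean_space) \<Rightarrow> ('b \<Rightarrow> 'b \<Rightarrow> 'b \<Rightarrow> real) \<Rightarrow> 'a \<Rightarrow> 'a \<Rightarrow> 'a \<Rightarrow> real"
  where
  "pullback_tensor f g x u v =
     g (f x) (frechet_derivative f (at x) u) (frechet_derivative f (at x) v)"

end

theory Submission
  imports Defs
begin

text \<open>
  Let \<open>\<phi> = F\<^sup>2 / 2\<close>, with Hessian \<open>G\<close> and inverse Hessian \<open>H\<close>. Since \<open>f\<close> preserves norms, it is an
  isometry of the Hessian metrics. Differentiating the isometry relation shows that
  \<open>g\<^sub>2(\<partial>\<^sub>i\<partial>\<^sub>jf, \<partial>\<^sub>kf)\<close> is totally symmetric; the equality of the Cartan forms says that its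
  trace vanishes, so every component \<open>u\<close> of \<open>f\<close> is a 1-homogeneous solution of \<open>H\<^sup>i\<^sup>j \<partial>\<^sub>i\<partial>\<^sub>ju = 0\<close>.

  Such a \<open>u\<close> is linear, by the argument of Hilbert and Alexandrov for the equality case of the
  Minkowski inequality. The vector field \<open>W\<^sup>i = det G \<cdot> H\<^sup>i\<^sup>a (\<partial>\<^sub>a\<partial>\<^sub>ku) H\<^sup>k\<^sup>j \<partial>\<^sub>ju\<close> has divergence
  \<open>det G \<cdot> |D\<^sup>2u|\<^sup>2\<close>, the norm being taken with respect to \<open>G\<close>, and by homogeneity it is tangent to
  the level sets of \<open>F\<close>. Multiplying \<open>W\<close> by a compactly supported function of \<open>\<phi>\<close> and integrating
  gives \<open>D\<^sup>2u = 0\<close>, and \<open>D f\<close> is constant because the punctured space is connected.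
\<close>

text \<open>At a single point the equation
  \<open>H\<^sup>i\<^sup>j \<partial>\<^sub>i\<partial>\<^sub>ju = 0\<close>, even together with
  \<open>x\<^sup>a \<partial>\<^sub>a\<partial>\<^sub>ku = 0\<close>, does not force the symmetric
  matrix \<open>D\<^sup>2u\<close> to vanish when n > 2; this is why an integration is needed. The
  field W comes from the Legendre map \<xi> = d\<phi>. In the coordinates \<xi> the vector
  \<open>p\<^sup>k = H\<^sup>k\<^sup>j \<partial>\<^sub>ju\<close> is the gradient of u, and W is
  the Piola transform of the covector field
  \<open>(\<partial>\<^sub>a\<partial>\<^sub>ku) p\<^sup>k\<close>. So its divergence has only two
  third-order contributions, one from u and one from the derivative of the inner H; the
  differentiated equation makes them cancel, and the square is left. The obstacle is the origin:
  \<open>D\<^sup>2\<phi>\<close> is 0-homogeneous, hence has no limit there unless it is constant,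
  and W lives on the punctured space only. A cutoff that depends on \<phi> alone costs nothing,
  because its differential is a multiple of d\<phi>, which annihilates W.\<close>

subsection \<open>Directional derivatives of smooth functions\<close>

text \<open>The direction comes first, so that \<open>dir_deriv v\<close> is an operator on
  functions that can be iterated; the recursion of \<open>Ck_on\<close> then becomes a statement
  about all \<open>dir_deriv v f\<close>.\<close>

definition dir_deriv :: "'a::euclidean_space \<Rightarrow> ('a \<Rightarrow> 'b::euclidean_space) \<Rightarrow> 'a \<Rightarrow> 'b" where
  "dir_deriv v h x = frechet_derivative h (at x) v"

lemma dir_derivI: "(h has_derivative h') (at x) \<Longrightarrow> dir_deriv v h x = h' v"
  unfolding dir_deriv_def by (metis frechet_derivative_at)

lemma has_derivative_dir_deriv:
  "h differentiable at x \<Longrightarrow> (h has_derivative (\<lambda>v. dir_deriv v h x)) (at x)"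
  unfolding dir_deriv_def by (simp add: frechet_derivative_works[symmetric])

lemma linear_dir_deriv: "h differentiable at x \<Longrightarrow> linear (\<lambda>v. dir_deriv v h x)"
  using has_derivative_dir_deriv has_derivative_linear by blast

lemma has_derivative_cong_open:
  assumes "open S" "x \<in> S" "\<And>y. y \<in> S \<Longrightarrow> f y = g y"
  shows "(f has_derivative f') (at x) \<longleftrightarrow> (g has_derivative f') (at x)"
  using assms by (auto elim: has_derivative_transform_within_open)

lemma dir_deriv_cong_open:
  assumes "open S" "x \<in> S" "\<And>y. y \<in> S \<Longrightarrow> f y = g y"
  shows "dir_deriv v f x = dir_deriv v g x"
  unfolding dir_deriv_def frechet_derivative_def by (simp add: has_derivative_cong_open[OF assms])

lemma Ck_on_Suc_dir_deriv:
  "Ck_on (Suc k) S f \<longleftrightarrow> (\<forall>x\<in>S. f differentiable at x) \<and> (\<forall>v. Ck_on k S (dir_deriv v f))"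
  by (simp add: dir_deriv_def[abs_def])

text \<open>The derivatives in \<open>Ck_on\<close> are taken in the full space; openness of S makes
  them depend on the values in S alone.\<close>

lemma Ck_on_cong:
  assumes "open S" "\<And>y. y \<in> S \<Longrightarrow> f y = g y"
  shows "Ck_on k S f \<longleftrightarrow> Ck_on k S g"
  using assms(2)
proof (induction k arbitrary: f g)
  case 0
  then show ?case by (simp cong: continuous_on_cong)
next
  case (Suc k)
  have "f differentiable at x \<longleftrightarrow> g differentiable at x" if "x \<in> S" for x
    using has_derivative_cong_open[OF assms(1) that Suc.prems] by (simp add: differentiable_def)
  moreover have "Ck_on k S (dir_deriv v f) \<longleftrightarrow> Ck_on k S (dir_deriv v g)" for v
    by (rule Suc.IH) (rule dir_deriv_cong_open[OF assms(1) _ Suc.prems])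
  ultimately show ?case by (simp add: Ck_on_Suc_dir_deriv del: Ck_on.simps(2))
qed

text \<open>The recursion of \<open>Ck_on\<close> drops the continuity of f itself; at the bottom it
  is recovered from differentiability, and above that the inclusion is inherited from the
  derivatives.\<close>

lemma Ck_on_Suc_imp: "Ck_on (Suc k) S f \<Longrightarrow> Ck_on k S f"
proof (induction k arbitrary: f)
  case 0
  then show ?case
    by (auto intro!: continuous_at_imp_continuous_on differentiable_imp_continuous_within)
next
  case (Suc k)
  then show ?case by (meson Ck_on.simps(2))
qed

lemma smooth_on_cong:
  "open S \<Longrightarrow> (\<And>y. y \<in> S \<Longrightarrow> f y = g y) \<Longrightarrow> smooth_on S f \<longleftrightarrow> smooth_on S g"
  unfolding smooth_on_def using Ck_on_cong by blast

lemma smooth_on_dir_deriv: "smooth_on S f \<Longrightarrow> smooth_on S (dir_deriv v f)"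
  unfolding smooth_on_def by (metis Ck_on_Suc_dir_deriv)

lemma smooth_on_differentiable: "smooth_on S f \<Longrightarrow> x \<in> S \<Longrightarrow> f differentiable at x"
  unfolding smooth_on_def by (metis Ck_on_Suc_dir_deriv)

lemma smooth_on_continuous: "smooth_on S f \<Longrightarrow> continuous_on S f"
  unfolding smooth_on_def by (metis Ck_on.simps(1))

lemma smooth_on_has_derivative:
  "smooth_on S f \<Longrightarrow> x \<in> S \<Longrightarrow> (f has_derivative (\<lambda>v. dir_deriv v f x)) (at x)"
  by (intro has_derivative_dir_deriv smooth_on_differentiable)

lemma Ck_on_const: "Ck_on k S (\<lambda>x. c)"
  by (induction k arbitrary: c) auto

lemma smooth_on_const: "smooth_on S (\<lambda>x. c)"
  by (simp add: smooth_on_def Ck_on_const)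

lemma dir_deriv_add:
  "f differentiable at x \<Longrightarrow> g differentiable at x \<Longrightarrow>
    dir_deriv v (\<lambda>y. f y + g y) x = dir_deriv v f x + dir_deriv v g x"
  by (rule dir_derivI) (intro derivative_intros has_derivative_dir_deriv)

lemma dir_deriv_mult:
  fixes f g :: "'a::euclidean_space \<Rightarrow> real"
  shows "f differentiable at x \<Longrightarrow> g differentiable at x \<Longrightarrow>
    dir_deriv v (\<lambda>y. f y * g y) x = dir_deriv v f x * g x + f x * dir_deriv v g x"
  by (subst dir_derivI[OF has_derivative_mult[OF has_derivative_dir_deriv has_derivative_dir_deriv]])
     auto

lemma dir_deriv_bounded_linear:
  assumes "bounded_linear L" "f differentiable at x"
  shows "dir_deriv v (\<lambda>y. L (f y)) x = L (dir_deriv v f x)"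
  by (rule dir_derivI) (rule bounded_linear.has_derivative[OF assms(1) has_derivative_dir_deriv[OF assms(2)]])

lemma dir_deriv_sum:
  "(\<And>i. i \<in> I \<Longrightarrow> f i differentiable at x) \<Longrightarrow>
    dir_deriv v (\<lambda>y. \<Sum>i\<in>I. f i y) x = (\<Sum>i\<in>I. dir_deriv v (f i) x)"
  by (rule dir_derivI) (intro derivative_intros has_derivative_dir_deriv, auto)

lemma Ck_on_add:
  assumes "open S"
  shows "Ck_on k S f \<Longrightarrow> Ck_on k S g \<Longrightarrow> Ck_on k S (\<lambda>x. f x + g x)"
proof (induction k arbitrary: f g)
  case 0
  then show ?case by (auto intro: continuous_intros)
next
  case (Suc k)
  have "Ck_on k S (dir_deriv v (\<lambda>x. f x + g x))" for v
  proof (subst Ck_on_cong[OF assms, of _ "\<lambda>x. dir_deriv v f x + dir_deriv v g x"])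
    show "dir_deriv v (\<lambda>x. f x + g x) y = dir_deriv v f y + dir_deriv v g y" if "y \<in> S" for y
      by (rule dir_deriv_add) (use Suc.prems that in auto)
  qed (use Suc in \<open>auto simp: Ck_on_Suc_dir_deriv simp del: Ck_on.simps(2)\<close>)
  with Suc.prems show ?case by (auto simp: Ck_on_Suc_dir_deriv simp del: Ck_on.simps(2))
qed

lemma Ck_on_mult:
  fixes f g :: "'a::euclidean_space \<Rightarrow> real"
  assumes "open S"
  shows "Ck_on k S f \<Longrightarrow> Ck_on k S g \<Longrightarrow> Ck_on k S (\<lambda>x. f x * g x)"
proof (induction k arbitrary: f g)
  case 0
  then show ?case by (auto intro: continuous_intros)
next
  case (Suc k)
  have "Ck_on k S (dir_deriv v (\<lambda>x. f x * g x))" for v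
  proof (subst Ck_on_cong[OF assms, of _ "\<lambda>x. dir_deriv v f x * g x + f x * dir_deriv v g x"])
    show "dir_deriv v (\<lambda>x. f x * g x) y = dir_deriv v f y * g y + f y * dir_deriv v g y" if "y \<in> S" for y
      by (rule dir_deriv_mult) (use Suc.prems that in auto)
    show "Ck_on k S (\<lambda>x. dir_deriv v f x * g x + f x * dir_deriv v g x)"
      using Suc Ck_on_Suc_imp[OF Suc.prems(1)] Ck_on_Suc_imp[OF Suc.prems(2)]
      by (intro Ck_on_add[OF assms] Suc.IH) (auto simp: Ck_on_Suc_dir_deriv simp del: Ck_on.simps(2))
  qed
  with Suc.prems show ?case by (auto simp: Ck_on_Suc_dir_deriv simp del: Ck_on.simps(2))
qed

text \<open>The derivative is kept as a product with two copies of the inverse instead of a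
  quotient, so that the induction hypothesis and \<open>Ck_on_mult\<close> cover it.\<close>

lemma Ck_on_inverse:
  fixes f :: "'a::euclidean_space \<Rightarrow> real"
  assumes "open S" "\<And>x. x \<in> S \<Longrightarrow> f x \<noteq> 0"
  shows "Ck_on k S f \<Longrightarrow> Ck_on k S (\<lambda>x. inverse (f x))"
proof (induction k)
  case 0
  then show ?case using assms(2) by (auto intro: continuous_intros)
next
  case (Suc k)
  have d: "((\<lambda>x. inverse (f x)) has_derivative (\<lambda>v. (- 1) * (inverse (f x) * (dir_deriv v f x * inverse (f x))))) (at x)"
    if "x \<in> S" for x
    using that Suc.prems assms(2)
    by (auto intro!: derivative_eq_intros has_derivative_dir_deriv)
  have "Ck_on k S (dir_deriv v (\<lambda>x. inverse (f x)))" for v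
  proof (subst Ck_on_cong[OF assms(1), of _ "\<lambda>x. (- 1) * (inverse (f x) * (dir_deriv v f x * inverse (f x)))"])
    show "Ck_on k S (\<lambda>x. (- 1) * (inverse (f x) * (dir_deriv v f x * inverse (f x))))"
      using Suc Ck_on_Suc_imp[OF Suc.prems]
      by (intro Ck_on_mult[OF assms(1)] Ck_on_const) (auto simp: Ck_on_Suc_dir_deriv simp del: Ck_on.simps(2))
  qed (rule dir_derivI[OF d])
  moreover have "\<forall>x\<in>S. (\<lambda>x. inverse (f x)) differentiable at x"
    using d differentiable_def by blast
  ultimately show ?case by (auto simp: Ck_on_Suc_dir_deriv simp del: Ck_on.simps(2))
qed

lemma smooth_on_add: "open S \<Longrightarrow> smooth_on S f \<Longrightarrow> smooth_on S g \<Longrightarrow> smooth_on S (\<lambda>x. f x + g x)"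
  unfolding smooth_on_def using Ck_on_add by blast

lemma smooth_on_mult:
  fixes f g :: "'a::euclidean_space \<Rightarrow> real"
  shows "open S \<Longrightarrow> smooth_on S f \<Longrightarrow> smooth_on S g \<Longrightarrow> smooth_on S (\<lambda>x. f x * g x)"
  unfolding smooth_on_def using Ck_on_mult by blast

lemma smooth_on_inverse:
  fixes f :: "'a::euclidean_space \<Rightarrow> real"
  shows "open S \<Longrightarrow> (\<And>x. x \<in> S \<Longrightarrow> f x \<noteq> 0) \<Longrightarrow> smooth_on S f \<Longrightarrow> smooth_on S (\<lambda>x. inverse (f x))"
  unfolding smooth_on_def using Ck_on_inverse by blast

lemma smooth_on_sum:
  assumes "open S" "\<And>i. i \<in> I \<Longrightarrow> smooth_on S (f i)"
  shows "smooth_on S (\<lambda>x. \<Sum>i\<in>I. f i x)"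
  using assms(2) by (induction I rule: infinite_finite_induct)
    (auto intro: smooth_on_const smooth_on_add[OF assms(1)])

lemma smooth_on_prod:
  fixes f :: "'i \<Rightarrow> 'a::euclidean_space \<Rightarrow> real"
  assumes "open S" "\<And>i. i \<in> I \<Longrightarrow> smooth_on S (f i)"
  shows "smooth_on S (\<lambda>x. \<Prod>i\<in>I. f i x)"
  using assms(2) by (induction I rule: infinite_finite_induct)
    (auto intro: smooth_on_const smooth_on_mult[OF assms(1)])

lemma Ck_on_bounded_linear:
  assumes "open S" "bounded_linear L"
  shows "Ck_on k S f \<Longrightarrow> Ck_on k S (\<lambda>x. L (f x))"
proof (induction k arbitrary: f)
  case 0
  then show ?case by (auto intro: bounded_linear.continuous_on[OF assms(2)])
next
  case (Suc k)
  have "Ck_on k S (dir_deriv v (\<lambda>x. L (f x)))" for v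
    by (subst Ck_on_cong[OF assms(1) dir_deriv_bounded_linear[OF assms(2)]])
       (use Suc in \<open>auto simp: Ck_on_Suc_dir_deriv simp del: Ck_on.simps(2)\<close>)
  moreover have "\<forall>x\<in>S. (\<lambda>x. L (f x)) differentiable at x"
    using Suc.prems bounded_linear.has_derivative[OF assms(2)] unfolding Ck_on.simps(2) differentiable_def
    by blast
  ultimately show ?case by (auto simp: Ck_on_Suc_dir_deriv simp del: Ck_on.simps(2))
qed

lemma smooth_on_bounded_linear:
  "open S \<Longrightarrow> bounded_linear L \<Longrightarrow> smooth_on S f \<Longrightarrow> smooth_on S (\<lambda>x. L (f x))"
  unfolding smooth_on_def using Ck_on_bounded_linear by blast

section \<open>Symmetry of second directional derivatives\<close>

lemma has_real_derivative_along_line: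
  fixes h :: "'a::euclidean_space \<Rightarrow> real"
  assumes "h differentiable at (p + s *\<^sub>R v)"
  shows "((\<lambda>s. h (p + s *\<^sub>R v)) has_real_derivative dir_deriv v h (p + s *\<^sub>R v)) (at s)"
proof -
  have "((\<lambda>s. p + s *\<^sub>R v) has_derivative (\<lambda>r. r *\<^sub>R v)) (at s)"
    by (auto intro!: derivative_eq_intros)
  from has_derivative_compose[OF this has_derivative_dir_deriv[OF assms]]
  have "((\<lambda>s. h (p + s *\<^sub>R v)) has_derivative (\<lambda>r. dir_deriv (r *\<^sub>R v) h (p + s *\<^sub>R v))) (at s)" .
  then show ?thesis
    by (simp add: has_field_derivative_def linear_scale[OF linear_dir_deriv[OF assms]] mult_commute_abs)
qed

text \<open>The mean value theorem is applied twice: in the direction u to the increment in the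
  direction v, then in the direction v to the derivative along u. The left side is symmetric in u
  and v, which is the point of the lemma.\<close>

lemma second_difference_mvt:
  fixes h :: "'a::euclidean_space \<Rightarrow> real"
  assumes "smooth_on S h" "ball x e \<subseteq> S" "t > 0" "t * norm u + t * norm v < e"
  shows "\<exists>\<xi>. dist x \<xi> \<le> t * norm u + t * norm v \<and>
    h (x + t *\<^sub>R u + t *\<^sub>R v) - h (x + t *\<^sub>R u) - h (x + t *\<^sub>R v) + h x = t\<^sup>2 * dir_deriv v (dir_deriv u h) \<xi>"
proof -
  have bound: "dist x (x + s *\<^sub>R u + r *\<^sub>R v) \<le> t * norm u + t * norm v"
    if "0 \<le> s" "s \<le> t" "0 \<le> r" "r \<le> t" for s r
  proof -
    have "dist x (x + s *\<^sub>R u + r *\<^sub>R v) = norm (s *\<^sub>R u + r *\<^sub>R v)"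
      by (metis add.assoc dist_0_norm dist_add_cancel add.right_neutral)
    also have "\<dots> \<le> s * norm u + r * norm v"
      using norm_triangle_ineq[of "s *\<^sub>R u" "r *\<^sub>R v"] that by simp
    also have "\<dots> \<le> t * norm u + t * norm v"
      using that by (intro add_mono mult_right_mono) auto
    finally show ?thesis .
  qed
  then have inS: "x + s *\<^sub>R u + r *\<^sub>R v \<in> S" if "0 \<le> s" "s \<le> t" "0 \<le> r" "r \<le> t" for s r
    using order_le_less_trans[OF bound[OF that] assms(4)] assms(2) by (auto simp: subset_iff)
  define k where "k s = h ((x + t *\<^sub>R v) + s *\<^sub>R u) - h (x + s *\<^sub>R u)" for s
  have dk: "(k has_real_derivative (dir_deriv u h ((x + t *\<^sub>R v) + s *\<^sub>R u) - dir_deriv u h (x + s *\<^sub>R u))) (at s)"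
    if "0 \<le> s" "s \<le> t" for s
    unfolding k_def using inS[of s t] inS[of s 0] that assms(1,3)
    by (intro DERIV_diff has_real_derivative_along_line smooth_on_differentiable[of S]) (auto simp: ac_simps)
  have "\<exists>s>0. s < t \<and> k t - k 0 =
      (t - 0) * (dir_deriv u h ((x + t *\<^sub>R v) + s *\<^sub>R u) - dir_deriv u h (x + s *\<^sub>R u))"
    by (rule MVT2[OF assms(3) dk])
  then obtain s where s: "0 < s" "s < t"
    "k t - k 0 = t * (dir_deriv u h ((x + t *\<^sub>R v) + s *\<^sub>R u) - dir_deriv u h (x + s *\<^sub>R u))"
    by auto
  have dm: "((\<lambda>r. dir_deriv u h ((x + s *\<^sub>R u) + r *\<^sub>R v)) has_real_derivative
        dir_deriv v (dir_deriv u h) ((x + s *\<^sub>R u) + r *\<^sub>R v)) (at r)"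
    if "0 \<le> r" "r \<le> t" for r
    using inS[of s r] s that smooth_on_dir_deriv[OF assms(1)]
    by (intro has_real_derivative_along_line smooth_on_differentiable[of S]) auto
  have "\<exists>r>0. r < t \<and> dir_deriv u h ((x + s *\<^sub>R u) + t *\<^sub>R v) - dir_deriv u h ((x + s *\<^sub>R u) + 0 *\<^sub>R v)
      = (t - 0) * dir_deriv v (dir_deriv u h) ((x + s *\<^sub>R u) + r *\<^sub>R v)"
    by (rule MVT2[OF assms(3) dm])
  then obtain r where r: "0 < r" "r < t"
    "dir_deriv u h ((x + s *\<^sub>R u) + t *\<^sub>R v) - dir_deriv u h (x + s *\<^sub>R u)
      = t * dir_deriv v (dir_deriv u h) ((x + s *\<^sub>R u) + r *\<^sub>R v)"
    by auto
  have "k t - k 0 = t * (t * dir_deriv v (dir_deriv u h) ((x + s *\<^sub>R u) + r *\<^sub>R v))"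
    unfolding s(3) r(3)[symmetric] by (simp add: ac_simps)
  then show ?thesis
    using bound[of s r] s r
    by (intro exI[of _ "(x + s *\<^sub>R u) + r *\<^sub>R v"]) (auto simp: k_def power2_eq_square ac_simps)
qed

text \<open>Schwarz's theorem: both mixed derivatives represent the same second difference, so they
  take a common value at points \<xi> and \<xi>' arbitrarily close to x, and continuity at x
  finishes.\<close>

theorem dir_deriv_commute:
  fixes h :: "'a::euclidean_space \<Rightarrow> real"
  assumes "open S" "smooth_on S h" "x \<in> S"
  shows "dir_deriv v (dir_deriv u h) x = dir_deriv u (dir_deriv v h) x"
proof (rule ccontr)
  assume neq: "\<not> ?thesis"
  define \<epsilon> where "\<epsilon> = dist (dir_deriv v (dir_deriv u h) x) (dir_deriv u (dir_deriv v h) x) / 2"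
  have "\<epsilon> > 0" using neq by (simp add: \<epsilon>_def)
  have cont: "continuous (at x) (dir_deriv v (dir_deriv u h))" for u v
    using assms smooth_on_continuous[OF smooth_on_dir_deriv[OF smooth_on_dir_deriv[OF assms(2)]]]
    by (simp add: continuous_on_eq_continuous_at)
  have "\<exists>d>0. \<forall>y. dist y x < d \<longrightarrow> dist (dir_deriv v (dir_deriv u h) y) (dir_deriv v (dir_deriv u h) x) < \<epsilon>" for u v
    using cont[of v u] \<open>\<epsilon> > 0\<close> unfolding continuous_at_eps_delta by blast
  then obtain d1 d2 where d: "d1 > 0" "d2 > 0"
    "\<And>y. dist y x < d1 \<Longrightarrow> dist (dir_deriv v (dir_deriv u h) y) (dir_deriv v (dir_deriv u h) x) < \<epsilon>"
    "\<And>y. dist y x < d2 \<Longrightarrow> dist (dir_deriv u (dir_deriv v h) y) (dir_deriv u (dir_deriv v h) x) < \<epsilon>"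
    by meson
  obtain e where e: "e > 0" "ball x e \<subseteq> S" using assms openE by blast
  define m where "m = min e (min d1 d2)"
  \<comment> \<open>The summand 1 avoids a zero denominator and makes the displacement
    \<open>t * norm u + t * norm v\<close> strictly smaller than m.\<close>
  define t where "t = m / (norm u + norm v + 1)"
  have "m > 0" using d e by (simp add: m_def)
  have pos: "norm u + norm v + 1 > 0" by (simp add: add_nonneg_pos)
  have "t > 0" using \<open>m > 0\<close> pos by (simp add: t_def)
  have "t * (norm u + norm v + 1) = m" using pos by (simp add: t_def)
  then have tm: "t * norm u + t * norm v < m" using \<open>t > 0\<close> by (simp add: algebra_simps)
  then have te: "t * norm u + t * norm v < e" by (simp add: m_def)
  obtain \<xi> where \<xi>: "dist x \<xi> \<le> t * norm u + t * norm v"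
    "h (x + t *\<^sub>R u + t *\<^sub>R v) - h (x + t *\<^sub>R u) - h (x + t *\<^sub>R v) + h x = t\<^sup>2 * dir_deriv v (dir_deriv u h) \<xi>"
    using second_difference_mvt[OF assms(2) e(2) \<open>t > 0\<close> te] by blast
  obtain \<xi>' where \<xi>': "dist x \<xi>' \<le> t * norm v + t * norm u"
    "h (x + t *\<^sub>R v + t *\<^sub>R u) - h (x + t *\<^sub>R v) - h (x + t *\<^sub>R u) + h x = t\<^sup>2 * dir_deriv u (dir_deriv v h) \<xi>'"
    using second_difference_mvt[OF assms(2) e(2) \<open>t > 0\<close>, of v u] te by (auto simp: add.commute)
  have "t\<^sup>2 * dir_deriv v (dir_deriv u h) \<xi> = t\<^sup>2 * dir_deriv u (dir_deriv v h) \<xi>'"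
    unfolding \<xi>(2)[symmetric] \<xi>'(2)[symmetric] by (simp add: algebra_simps)
  then have eq: "dir_deriv v (dir_deriv u h) \<xi> = dir_deriv u (dir_deriv v h) \<xi>'"
    using \<open>t > 0\<close> by simp
  have "dist (dir_deriv v (dir_deriv u h) \<xi>) (dir_deriv v (dir_deriv u h) x) < \<epsilon>"
    using \<xi>(1) tm by (intro d(3)) (simp add: m_def dist_commute)
  moreover have "dist (dir_deriv u (dir_deriv v h) \<xi>') (dir_deriv u (dir_deriv v h) x) < \<epsilon>"
    using \<xi>'(1) tm by (intro d(4)) (simp add: m_def dist_commute)
  ultimately show False
    unfolding eq \<epsilon>_def by (smt (verit) dist_triangle2 dist_commute field_sum_of_halves)
qed

subsection \<open>Integrals of derivatives\<close>

lemma integral_lborel_translate: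
  fixes h :: "'a::euclidean_space \<Rightarrow> real"
  assumes "h \<in> borel_measurable borel"
  shows "integral\<^sup>L lborel (\<lambda>x. h (c + x)) = integral\<^sup>L lborel h"
proof -
  have "integral\<^sup>L (distr lborel borel ((+) c)) h = integral\<^sup>L lborel (\<lambda>x. h (c + x))"
    by (intro integral_distr) (use assms in auto)
  then show ?thesis by (simp add: lborel_distr_plus)
qed

text \<open>By translation invariance the difference quotients \<open>q n\<close> have integral 0,
  and dominated convergence passes this on to the derivative. It serves as the divergence theorem
  for compact support, one direction at a time.\<close>

lemma integral_dir_deriv_eq_0:
  fixes h :: "'a::euclidean_space \<Rightarrow> real"
  assumes diff: "\<And>x. h differentiable at x" and cont: "continuous_on UNIV (dir_deriv v h)"
    and supp: "\<And>x. norm x > R \<Longrightarrow> h x = 0"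
  shows "integrable lborel (dir_deriv v h)" "integral\<^sup>L lborel (dir_deriv v h) = 0"
proof -
  have opn: "open {x::'a. norm x > R}" by (intro open_Collect_less continuous_intros)
  have supp': "dir_deriv v h x = 0" if "norm x > R" for x
    using dir_deriv_cong_open[OF opn, of x h "\<lambda>_. 0" v] that supp by (simp add: dir_deriv_def)
  have conth: "continuous_on UNIV h"
    using diff by (auto intro: continuous_at_imp_continuous_on differentiable_imp_continuous_within)
  have int: "integrable lborel k" if "continuous_on UNIV k" "\<And>x. norm x > R \<Longrightarrow> k x = 0" for k :: "'a \<Rightarrow> real"
  proof -
    have "integrable lborel (\<lambda>x. indicator (cball 0 R) x *\<^sub>R k x)"
      by (rule borel_integrable_compact) (use that in \<open>auto intro: continuous_on_subset\<close>)
    moreover have "(\<lambda>x. indicator (cball 0 R) x *\<^sub>R k x) = k"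
      using that(2) by (force simp: indicator_def)
    ultimately show ?thesis by simp
  qed
  show "integrable lborel (dir_deriv v h)" using int cont supp' by blast
  have "bounded (dir_deriv v h ` cball 0 R)"
    by (intro compact_imp_bounded compact_continuous_image) (use cont in \<open>auto intro: continuous_on_subset\<close>)
  then obtain B where B: "\<And>x. x \<in> cball 0 R \<Longrightarrow> \<bar>dir_deriv v h x\<bar> \<le> B" "B > 0"
    unfolding bounded_pos by force
  have bound: "\<bar>dir_deriv v h x\<bar> \<le> B" for x
    using B supp'[of x] by (cases "norm x > R") auto
  define t where "t n = inverse (real (Suc n))" for n
  have t: "0 < t n" "t n \<le> 1" for n by (auto simp: t_def inverse_le_1_iff)
  define q where "q n x = (h (t n *\<^sub>R v + x) - h x) / t n" for n x
  \<comment> \<open>The dominating function lives on the ball of radius \<open>R + norm v\<close>: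
    since \<open>t n\<close> is at most 1, a point outside it stays outside the support after the
    shift by \<open>t n *\<^sub>R v\<close>; inside, the mean value theorem bounds the quotient by
    B.\<close>
  have "(\<lambda>n. integral\<^sup>L lborel (q n)) \<longlonglongrightarrow> integral\<^sup>L lborel (dir_deriv v h)"
  proof (rule integral_dominated_convergence[where w="\<lambda>x. indicator (cball 0 (R + norm v)) x *\<^sub>R B"])
    show "dir_deriv v h \<in> borel_measurable lborel"
      using cont by (simp add: borel_measurable_continuous_onI)
    show "q n \<in> borel_measurable lborel" for n
      unfolding q_def
      by (simp, rule borel_measurable_continuous_onI, intro continuous_intros)
         (use t[of n] conth in \<open>auto intro!: continuous_intros continuous_on_compose2[OF conth]\<close>)
    show "integrable lborel (\<lambda>x. indicator (cball 0 (R + norm v)) x *\<^sub>R B)"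
      by (rule borel_integrable_compact) auto
    show "AE x in lborel. (\<lambda>n. q n x) \<longlonglongrightarrow> dir_deriv v h x"
    proof (rule AE_I2)
      fix x
      have "((\<lambda>s. h (x + s *\<^sub>R v)) has_real_derivative dir_deriv v h x) (at 0)"
        using has_real_derivative_along_line[of h x 0 v] diff by simp
      then have "((\<lambda>s. (h (x + s *\<^sub>R v) - h x) / s) \<longlongrightarrow> dir_deriv v h x) (at 0)"
        unfolding DERIV_def by simp
      moreover have "filterlim t (at 0) sequentially"
        unfolding filterlim_at using LIMSEQ_inverse_real_of_nat t(1)
        by (auto simp: t_def[abs_def])
      ultimately have "(\<lambda>n. (h (x + t n *\<^sub>R v) - h x) / t n) \<longlonglongrightarrow> dir_deriv v h x"
        by (rule filterlim_compose)
      then show "(\<lambda>n. q n x) \<longlonglongrightarrow> dir_deriv v h x" by (simp add: q_def add.commute)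
    qed
    show "AE x in lborel. norm (q n x) \<le> indicator (cball 0 (R + norm v)) x *\<^sub>R B" for n
    proof (rule AE_I2)
      fix x
      show "norm (q n x) \<le> indicator (cball 0 (R + norm v)) x *\<^sub>R B"
      proof (cases "norm x \<le> R + norm v")
        case True
        have "\<exists>s>0. s < t n \<and> h (x + t n *\<^sub>R v) - h (x + 0 *\<^sub>R v) = (t n - 0) * dir_deriv v h (x + s *\<^sub>R v)"
          by (rule MVT2[OF t(1)]) (rule has_real_derivative_along_line[OF diff])
        then obtain s where "h (x + t n *\<^sub>R v) - h x = t n * dir_deriv v h (x + s *\<^sub>R v)" by auto
        then have "q n x = dir_deriv v h (x + s *\<^sub>R v)"
          using t(1)[of n] by (simp add: q_def add.commute)
        then show ?thesis using bound True by simp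
      next
        case False
        have "norm x \<le> norm (t n *\<^sub>R v + x) + norm (t n *\<^sub>R v)"
          by (metis add.commute add_diff_cancel_left' norm_triangle_sub norm_minus_commute)
        also have "norm (t n *\<^sub>R v) \<le> norm v" using t[of n] by (simp add: mult_left_le_one_le)
        finally have "norm (t n *\<^sub>R v + x) > R" using False by simp
        moreover have "norm x > R" using False norm_ge_zero[of v] by linarith
        ultimately show ?thesis using False by (simp add: q_def supp)
      qed
    qed
  qed
  moreover have "integral\<^sup>L lborel (q n) = 0" for n
  proof -
    have m: "h \<in> borel_measurable borel" using conth by (rule borel_measurable_continuous_onI)
    have ih: "integrable lborel h" using int conth supp by blast
    moreover have "integrable lborel (\<lambda>x. h (t n *\<^sub>R v + x))"
    proof -
      have "integrable (distr lborel borel ((+) (t n *\<^sub>R v))) h" using ih by (simp add: lborel_distr_plus)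
      then show ?thesis using m by (subst (asm) integrable_distr_eq) auto
    qed
    ultimately show ?thesis unfolding q_def by (simp add: integral_lborel_translate[OF m])
  qed
  ultimately show "integral\<^sup>L lborel (dir_deriv v h) = 0"
    by (simp add: LIMSEQ_const_iff)
qed

text \<open>The zero set of q is closed and has full measure, so its complement is an open null set,
  hence empty.\<close>

lemma continuous_nonneg_integral_eq_0:
  fixes q :: "'a::euclidean_space \<Rightarrow> real"
  assumes "continuous_on UNIV q" "\<And>x. q x \<ge> 0" "integrable lborel q" "integral\<^sup>L lborel q = 0"
  shows "q x = 0"
proof -
  have "AE x in lborel. q x = 0"
    using integral_nonneg_eq_0_iff_AE[OF assms(3)] assms by simp
  then have "AE x in lebesgue. x \<in> UNIV \<longrightarrow> x \<in> {x. q x = 0}"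
    using AE_completion by auto
  moreover have "closed {x. q x = 0}"
    using assms(1) by (intro closed_Collect_eq) auto
  ultimately have "x \<in> {x. q x = 0}"
    using mem_closed_if_AE_lebesgue_open[of UNIV "{x. q x = 0}" x] by auto
  then show ?thesis by simp
qed

subsection \<open>Determinants and positive definite matrices\<close>

text \<open>A permutation other than the identity moves at least two indices; after one factor of
  its Leibniz product is differentiated, another factor is an off-diagonal entry of the identity
  matrix and vanishes. Only the identity permutation contributes, and it gives the trace.\<close>

lemma det_has_derivative_at_mat_1:
  fixes N :: "'a::real_normed_vector \<Rightarrow> real^'n^'n"
  assumes "\<And>i j. ((\<lambda>y. N y $ i $ j) has_derivative (\<lambda>v. N' v $ i $ j)) (at x)" "N x = mat 1"
  shows "((\<lambda>y. det (N y)) has_derivative (\<lambda>v. trace (N' v))) (at x)"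
proof -
  have "((\<lambda>y. det (N y)) has_derivative
      (\<lambda>v. \<Sum>p | p permutes UNIV. of_int (sign p) * (\<Sum>i\<in>UNIV. N' v $ i $ p i * (\<Prod>j\<in>UNIV - {i}. N x $ j $ p j)))) (at x)"
    unfolding det_def by (auto intro!: derivative_eq_intros assms(1))
  moreover have "(\<Sum>p | p permutes UNIV. of_int (sign p) * (\<Sum>i\<in>UNIV. N' v $ i $ p i * (\<Prod>j\<in>UNIV - {i}. N x $ j $ p j)))
      = trace (N' v)" for v
  proof -
    have z: "(\<Prod>j\<in>UNIV - {i}. N x $ j $ p j) = 0" if "p permutes UNIV" and "p \<noteq> id" for p :: "'n \<Rightarrow> 'n" and i
    proof -
      obtain k where k: "p k \<noteq> k" using \<open>p \<noteq> id\<close> by (auto simp: fun_eq_iff)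
      have "p (p k) \<noteq> p k" using k permutes_inj[OF that(1)] by (metis injD)
      with k obtain j where "j \<noteq> i" "p j \<noteq> j" by metis
      then show ?thesis by (intro prod_zero) (auto simp: assms(2) mat_def intro!: bexI[of _ j])
    qed
    have "(\<Sum>p | p permutes UNIV. of_int (sign p) * (\<Sum>i\<in>UNIV. N' v $ i $ p i * (\<Prod>j\<in>UNIV - {i}. N x $ j $ p j)))
       = (\<Sum>p\<in>{id}. of_int (sign p) * (\<Sum>i\<in>UNIV. N' v $ i $ p i * (\<Prod>j\<in>UNIV - {i}. N x $ j $ p j)))"
      by (rule sum.mono_neutral_right) (auto simp: finite_permutations permutes_id z)
    also have "\<dots> = trace (N' v)"
      by (auto simp: sign_id trace_def assms(2) mat_def intro!: sum.cong)
    finally show ?thesis .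
  qed
  ultimately show ?thesis by simp
qed

text \<open>Jacobi's formula. Multiplying by the constant matrix H, the inverse of
  \<open>G x\<close>, moves the base point to the identity matrix.\<close>

lemma det_has_derivative:
  fixes G :: "'a::real_normed_vector \<Rightarrow> real^'n^'n"
  assumes "\<And>i j. ((\<lambda>y. G y $ i $ j) has_derivative (\<lambda>v. G' v $ i $ j)) (at x)" "H ** G x = mat 1"
  shows "((\<lambda>y. det (G y)) has_derivative (\<lambda>v. det (G x) * trace (H ** G' v))) (at x)"
proof -
  have "((\<lambda>y. det (H ** G y)) has_derivative (\<lambda>v. trace (H ** G' v))) (at x)"
    by (rule det_has_derivative_at_mat_1)
       (use assms(2) in \<open>auto simp: matrix_matrix_mult_def intro!: derivative_eq_intros assms(1)\<close>)
  then have "((\<lambda>y. det (G x) * det (H ** G y)) has_derivative (\<lambda>v. det (G x) * trace (H ** G' v))) (at x)"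
    by (rule has_derivative_mult_right)
  moreover have "det (G x) * det (H ** G y) = det (G y)" for y
    using arg_cong[OF assms(2), of det] by (simp add: det_mul algebra_simps)
  ultimately show ?thesis by simp
qed

section \<open>Positive definite matrices and their inverses\<close>

definition posdef_matrix :: "real^'n^'n \<Rightarrow> bool" where
  "posdef_matrix G \<longleftrightarrow> transpose G = G \<and> (\<forall>v. v \<noteq> 0 \<longrightarrow> v \<bullet> (G *v v) > 0)"

lemma posdef_matrix_commute: "posdef_matrix G \<Longrightarrow> v \<bullet> (G *v w) = w \<bullet> (G *v v)"
  by (metis dot_lmul_matrix inner_commute posdef_matrix_def transpose_matrix_vector)

lemma posdef_matrix_inverse:
  assumes "posdef_matrix G"
  shows "matrix_inv G ** G = mat 1" "G ** matrix_inv G = mat 1"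
proof -
  have "inj ((*v) G)"
  proof (rule injI)
    fix v w assume "G *v v = G *v w"
    then have "(v - w) \<bullet> (G *v (v - w)) = 0" by (simp add: matrix_vector_mult_diff_distrib)
    then show "v = w" using assms unfolding posdef_matrix_def
      by (metis less_irrefl right_minus_eq)
  qed
  then have "\<exists>A. G ** A = mat 1 \<and> A ** G = mat 1"
    by (metis matrix_left_invertible_injective matrix_left_right_inverse)
  then have "G ** matrix_inv G = mat 1 \<and> matrix_inv G ** G = mat 1"
    unfolding matrix_inv_def by (rule someI_ex)
  then show "matrix_inv G ** G = mat 1" "G ** matrix_inv G = mat 1" by auto
qed

text \<open>Gram-Schmidt for the inner product of G, without normalisation.\<close>

lemma posdef_orthogonal_basis:
  fixes G :: "real^'n^'n"
  assumes "posdef_matrix G" "finite B"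
  shows "\<exists>C. finite C \<and> span C = span B \<and> pairwise (\<lambda>x y. x \<bullet> (G *v y) = 0) C"
  using assms(2)
proof (induction rule: finite_induct)
  case empty
  then show ?case using pairwise_empty by blast
next
  case (insert a B)
  then obtain C where C: "finite C" "span C = span B" "pairwise (\<lambda>x y. x \<bullet> (G *v y) = 0) C"
    by blast
  \<comment> \<open>C may contain the zero vector; its term, a division by 0 with value 0,
    contributes nothing.\<close>
  define s where "s = (\<Sum>x\<in>C. (x \<bullet> (G *v a) / (x \<bullet> (G *v x))) *\<^sub>R x)"
  have "s \<in> span C" unfolding s_def by (intro span_sum span_scale span_base)
  have "x - k *\<^sub>R (a - s) \<in> span C \<longleftrightarrow> x - k *\<^sub>R a \<in> span C" for x k
  proof -
    have "x - k *\<^sub>R (a - s) = k *\<^sub>R s + (x - k *\<^sub>R a)" by (simp add: scaleR_diff_right)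
    then show ?thesis using \<open>s \<in> span C\<close> by (simp only: span_add_eq span_scale)
  qed
  then have "span (insert (a - s) C) = span (insert a B)"
    unfolding set_eq_iff span_breakdown_eq C(2)[symmetric] by auto
  moreover have "y \<bullet> (G *v (a - s)) = 0" if "y \<in> C" for y
  proof -
    have "y \<bullet> (G *v s) = (\<Sum>x\<in>C. (x \<bullet> (G *v a) / (x \<bullet> (G *v x))) * (y \<bullet> (G *v x)))"
      unfolding s_def by (simp add: linear_sum[OF matrix_vector_mul_linear] inner_sum_right matrix_vector_mult_scaleR)
    also have "\<dots> = (\<Sum>x\<in>{y}. (x \<bullet> (G *v a) / (x \<bullet> (G *v x))) * (y \<bullet> (G *v x)))"
      using C that by (intro sum.mono_neutral_right) (auto simp: pairwise_def)
    also have "\<dots> = y \<bullet> (G *v a)"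
      using assms(1) by (cases "y = 0") (auto simp: posdef_matrix_def order_less_imp_not_eq2)
    finally show ?thesis by (simp add: matrix_vector_mult_diff_distrib inner_diff_right)
  qed
  moreover from this have "(a - s) \<bullet> (G *v y) = 0" if "y \<in> C" for y
    using that posdef_matrix_commute[OF assms(1)] by metis
  ultimately show ?case
    using C by (intro exI[of _ "insert (a - s) C"]) (auto simp: pairwise_insert)
qed

text \<open>The operator P expands a vector in a G-orthogonal basis; it fixes the basis and hence is
  the identity. Applied to the j-th column of H, which G sends to the j-th unit vector, the
  expansion has the coefficients \<open>c $ j / (c \<bullet> (G *v c))\<close>.\<close>

lemma posdef_inverse_decomposition:
  fixes G H :: "real^'n^'n"
  assumes "posdef_matrix G" "G ** H = mat 1"
  obtains C where "finite C" "span C = UNIV" "0 \<notin> C"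
    "\<And>i j. H $ i $ j = (\<Sum>c\<in>C. c $ i * c $ j / (c \<bullet> (G *v c)))"
proof -
  obtain C0 where C0: "finite C0" "span C0 = span (Basis :: (real^'n) set)" "pairwise (\<lambda>x y. x \<bullet> (G *v y) = 0) C0"
    using posdef_orthogonal_basis[OF assms(1) finite_Basis] by blast
  define C where "C = C0 - {0}"
  have C: "finite C" "span C = UNIV" "pairwise (\<lambda>x y. x \<bullet> (G *v y) = 0) C" "0 \<notin> C"
    using C0 by (auto simp: C_def span_delete_0 intro: pairwise_subset)
  define P where "P v = (\<Sum>c\<in>C. (c \<bullet> (G *v v) / (c \<bullet> (G *v c))) *\<^sub>R c)" for v
  have "linear P"
    unfolding P_def by (intro linear_compose_sum ballI)
      (auto intro!: linearI simp: matrix_vector_right_distrib inner_right_distrib add_divide_distrib scaleR_add_left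
        matrix_vector_mult_scaleR)
  moreover have "P v = v" if "v \<in> C" for v
  proof -
    have "P v = (\<Sum>c\<in>{v}. (c \<bullet> (G *v v) / (c \<bullet> (G *v c))) *\<^sub>R c)"
      unfolding P_def using C that by (intro sum.mono_neutral_right) (auto simp: pairwise_def)
    also have "\<dots> = v" using assms(1) C(4) that by (auto simp: posdef_matrix_def order_less_imp_not_eq2)
    finally show ?thesis .
  qed
  ultimately have P: "P v = v" for v
    using linear_eq_on_span[of P id C v] linear_id C(2) by auto
  have "H $ i $ j = (\<Sum>c\<in>C. c $ i * c $ j / (c \<bullet> (G *v c)))" for i j
  proof -
    have "G *v (H *v axis j 1) = axis j 1"
      by (simp add: matrix_vector_mul_assoc assms(2))
    then have "P (H *v axis j 1) $ i = (\<Sum>c\<in>C. c $ i * c $ j / (c \<bullet> (G *v c)))"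
      unfolding P_def by (simp add: inner_axis mult.commute)
    then show ?thesis
      unfolding P by (simp add: matrix_vector_mul_component inner_axis)
  qed
  with C that show thesis by blast
qed

text \<open>Q is the squared norm of the bilinear form U in the inner product given by H. Inserting
  the decomposition of H turns it into a sum, with positive weights, of squares of the values
  \<open>q c d\<close> of U on pairs from a G-orthogonal basis.\<close>

lemma posdef_contraction_nonneg:
  fixes G H U :: "real^'n^'n"
  assumes "posdef_matrix G" "G ** H = mat 1"
  defines "Q \<equiv> (\<Sum>i\<in>UNIV. \<Sum>a\<in>UNIV. \<Sum>b\<in>UNIV. \<Sum>j\<in>UNIV. H $ i $ a * H $ b $ j * (U $ a $ b * U $ i $ j))"
  shows "Q \<ge> 0" "Q = 0 \<Longrightarrow> U = 0"
proof -
  obtain C where C: "finite C" "span C = UNIV" "0 \<notin> C"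
    "\<And>i j. H $ i $ j = (\<Sum>c\<in>C. c $ i * c $ j / (c \<bullet> (G *v c)))"
    using posdef_inverse_decomposition[OF assms(1,2)] by blast
  define k where "k c = inverse (c \<bullet> (G *v c))" for c
  have k: "k c > 0" if "c \<in> C" for c
    using that C(3) assms(1) unfolding k_def posdef_matrix_def by (metis positive_imp_inverse_positive)
  define q where "q c d = (\<Sum>a\<in>UNIV. \<Sum>b\<in>UNIV. c $ a * d $ b * U $ a $ b)" for c d :: "real^'n"
  have H: "H $ i $ j = (\<Sum>c\<in>C. k c * (c $ i * c $ j))" for i j
    by (simp add: C(4) k_def field_simps)
  have "Q = (\<Sum>c\<in>C. \<Sum>d\<in>C. \<Sum>i\<in>UNIV. \<Sum>a\<in>UNIV. \<Sum>b\<in>UNIV. \<Sum>j\<in>UNIV.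
      k c * (c $ i * c $ a) * (k d * (d $ b * d $ j)) * (U $ a $ b * U $ i $ j))"
    unfolding Q_def H unfolding sum_product unfolding sum_distrib_right
    by (simp only: sum.swap[where A="UNIV::'n set" and B=C])
  also have "\<dots> = (\<Sum>c\<in>C. \<Sum>d\<in>C. k c * k d * (q c d)\<^sup>2)"
  proof (intro sum.cong refl)
    fix c d
    have "(q c d)\<^sup>2 = (\<Sum>i\<in>UNIV. \<Sum>j\<in>UNIV. \<Sum>a\<in>UNIV. \<Sum>b\<in>UNIV. (c $ i * d $ j * U $ i $ j) * (c $ a * d $ b * U $ a $ b))"
      unfolding q_def power2_eq_square sum_distrib_left sum_distrib_right
      by (intro sum.cong refl) (rule mult.commute)
    also have "\<dots> = (\<Sum>i\<in>UNIV. \<Sum>a\<in>UNIV. \<Sum>b\<in>UNIV. \<Sum>j\<in>UNIV. (c $ i * d $ j * U $ i $ j) * (c $ a * d $ b * U $ a $ b))"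
      by (rule sum.cong[OF refl], subst sum.swap, rule sum.cong[OF refl], rule sum.swap)
    finally show "(\<Sum>i\<in>UNIV. \<Sum>a\<in>UNIV. \<Sum>b\<in>UNIV. \<Sum>j\<in>UNIV.
      k c * (c $ i * c $ a) * (k d * (d $ b * d $ j)) * (U $ a $ b * U $ i $ j)) = k c * k d * (q c d)\<^sup>2"
      by (simp add: sum_distrib_left ac_simps)
  qed
  finally have Q: "Q = (\<Sum>c\<in>C. \<Sum>d\<in>C. k c * k d * (q c d)\<^sup>2)" .
  have nn: "k c * k d * (q c d)\<^sup>2 \<ge> 0" if "c \<in> C" "d \<in> C" for c d
    using k[OF that(1)] k[OF that(2)] by simp
  show "Q \<ge> 0" unfolding Q by (intro sum_nonneg nn)
  assume "Q = 0"
  have q0: "q c d = 0" if "c \<in> C" "d \<in> C" for c d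
  proof -
    have "(\<Sum>d\<in>C. k c * k d * (q c d)\<^sup>2) = 0"
      using \<open>Q = 0\<close> that(1) unfolding Q by (subst (asm) sum_nonneg_eq_0_iff) (auto intro!: sum_nonneg nn C(1))
    then have "k c * k d * (q c d)\<^sup>2 = 0"
      using that by (subst (asm) sum_nonneg_eq_0_iff) (auto intro!: nn C(1))
    then show ?thesis using k that by force
  qed
  have qeq: "q c d = c \<bullet> (U *v d)" for c d
    by (simp add: q_def inner_vec_def matrix_vector_mult_def sum_distrib_left ac_simps)
  have "c \<bullet> (U *v d) = 0" if "c \<in> C" for c d
  proof -
    have "linear (\<lambda>d. c \<bullet> (U *v d))"
      by (auto intro!: linearI simp: matrix_vector_right_distrib inner_right_distrib matrix_vector_mult_scaleR)
    from linear_eq_on_span[OF this linear_zero, of C d] show ?thesis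
      using q0[OF that] C(2) by (auto simp: qeq)
  qed
  then have "c \<bullet> (U *v d) = 0" for c d
  proof -
    have "linear (\<lambda>c. c \<bullet> (U *v d))"
      by (auto intro!: linearI simp: inner_left_distrib)
    from linear_eq_on_span[OF this linear_zero, of C c] show ?thesis
      using \<open>\<And>d c. c \<in> C \<Longrightarrow> c \<bullet> (U *v d) = 0\<close> C(2) by auto
  qed
  then have "U *v d = 0 *v d" for d by (metis inner_eq_zero_iff matrix_vector_mult_0)
  then show "U = 0" by (metis matrix_eq)
qed

subsection \<open>Homogeneous functions and Minkowski norms in coordinates\<close>

lemma open_punctured: "open (punctured :: 'a::euclidean_space set)"
  by (simp add: open_Compl)

lemma dir_deriv_homogeneous:
  fixes h :: "'a::euclidean_space \<Rightarrow> real"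
  assumes "smooth_on punctured h" "x \<noteq> 0" "t > 0"
    and hom: "\<And>y t. y \<noteq> 0 \<Longrightarrow> t > 0 \<Longrightarrow> h (t *\<^sub>R y) = t ^ Suc k * h y"
  shows "dir_deriv v h (t *\<^sub>R x) = t ^ k * dir_deriv v h x"
proof -
  have dif: "h differentiable at y" if "y \<noteq> 0" for y
    using smooth_on_differentiable[OF assms(1)] that by simp
  have "((\<lambda>y. t *\<^sub>R y) has_derivative (\<lambda>v. t *\<^sub>R v)) (at x)"
    by (auto intro!: derivative_eq_intros)
  from has_derivative_compose[OF this has_derivative_dir_deriv[OF dif]]
  have "((\<lambda>y. h (t *\<^sub>R y)) has_derivative (\<lambda>v. dir_deriv (t *\<^sub>R v) h (t *\<^sub>R x))) (at x)"
    using assms by simp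
  then have "dir_deriv v (\<lambda>y. h (t *\<^sub>R y)) x = dir_deriv (t *\<^sub>R v) h (t *\<^sub>R x)" by (rule dir_derivI)
  also have "\<dots> = t * dir_deriv v h (t *\<^sub>R x)"
    using linear_scale[OF linear_dir_deriv[OF dif]] assms by simp
  finally have "t * dir_deriv v h (t *\<^sub>R x) = dir_deriv v (\<lambda>y. h (t *\<^sub>R y)) x" ..
  also have "\<dots> = dir_deriv v (\<lambda>y. t ^ Suc k * h y) x"
    by (rule dir_deriv_cong_open[of punctured]) (use assms in auto)
  also have "\<dots> = t ^ Suc k * dir_deriv v h x"
    by (rule dir_derivI) (intro has_derivative_mult_right has_derivative_dir_deriv dif assms)
  finally show ?thesis using assms by simp
qed

lemma dir_deriv_euler:
  fixes h :: "'a::euclidean_space \<Rightarrow> real"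
  assumes "h differentiable at x" and hom: "\<And>t. t > 0 \<Longrightarrow> h (t *\<^sub>R x) = t ^ k * h x"
  shows "dir_deriv x h x = real k * h x"
proof -
  have "((\<lambda>s. h (x + s *\<^sub>R x)) has_real_derivative dir_deriv x h x) (at 0)"
    using has_real_derivative_along_line[of h x 0 x] assms by simp
  moreover have "((\<lambda>s. h (x + s *\<^sub>R x)) has_real_derivative real k * h x) (at 0)"
  proof (rule has_field_derivative_transform_within_open[of "\<lambda>s. (1 + s) ^ k * h x" _ _ "{- 1<..}"])
    show "((\<lambda>s. (1 + s) ^ k * h x) has_real_derivative real k * h x) (at 0)"
      by (auto intro!: derivative_eq_intros)
    \<comment> \<open>Homogeneity is available for positive factors only, so the comparison is
      restricted to s > -1.\<close>
    show "(1 + s) ^ k * h x = h (x + s *\<^sub>R x)" if "s \<in> {- 1<..}" for s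
      using hom[of "1 + s"] that by (simp add: scaleR_add_left)
  qed auto
  ultimately show ?thesis by (rule DERIV_unique)
qed

lemma vector_basis_coords:
  assumes "vector_basis b"
  obtains c where "x = (\<Sum>i\<in>UNIV. c i *\<^sub>R b i)"
proof -
  have "x \<in> span (range b)" using assms by (simp add: vector_basis_def)
  then obtain u where "x = (\<Sum>v\<in>range b. u v *\<^sub>R v)"
    using span_finite[of "range b"] by auto
  then have "x = (\<Sum>i\<in>UNIV. u (b i) *\<^sub>R b i)"
    using assms by (simp add: sum.reindex vector_basis_def o_def)
  then show thesis using that[of "\<lambda>i. u (b i)"] by blast
qed

lemma vector_basis_independent:
  assumes "vector_basis b" "(\<Sum>i\<in>UNIV. c i *\<^sub>R b i) = 0"
  shows "c i = 0"
proof (rule ccontr)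
  assume "c i \<noteq> 0"
  have inj: "inj b" using assms by (simp add: vector_basis_def)
  have "(\<Sum>v\<in>range b. c (inv b v) *\<^sub>R v) = 0"
    using assms inj by (simp add: sum.reindex o_def)
  moreover have "c (inv b (b i)) \<noteq> 0" using \<open>c i \<noteq> 0\<close> inj by simp
  ultimately have "dependent (range b)"
    by (subst dependent_finite) (auto intro!: exI[of _ "\<lambda>v. c (inv b v)"])
  then show False using assms by (simp add: vector_basis_def)
qed

lemma dir_deriv_coords:
  fixes h :: "'a::euclidean_space \<Rightarrow> real"
  assumes "h differentiable at x"
  shows "dir_deriv (\<Sum>i\<in>I. c i *\<^sub>R w i) h x = (\<Sum>i\<in>I. c i * dir_deriv (w i) h x)"
  using linear_dir_deriv[OF assms, THEN linear_sum, of "\<lambda>i. c i *\<^sub>R w i" I]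
  by (simp add: linear_scale[OF linear_dir_deriv[OF assms]])

text \<open>Linearity in the inner direction follows from linearity in the outer one, after the two
  derivatives are exchanged.\<close>

lemma dir_deriv_coords2:
  fixes h :: "'a::euclidean_space \<Rightarrow> real"
  assumes "open S" "smooth_on S h" "x \<in> S"
  shows "dir_deriv v (dir_deriv (\<Sum>i\<in>I. c i *\<^sub>R w i) h) x = (\<Sum>i\<in>I. c i * dir_deriv v (dir_deriv (w i) h) x)"
  using dir_deriv_coords[OF smooth_on_differentiable[OF smooth_on_dir_deriv[OF assms(2)] assms(3)]]
  by (simp add: dir_deriv_commute[OF assms, of v])

text \<open>On the segment from the identity matrix to G all matrices are positive definite, hence
  invertible; by the intermediate value theorem the determinant keeps the sign of its value 1 at the
  identity.\<close>

lemma posdef_matrix_det_pos: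
  fixes G :: "real^'n^'n"
  assumes "posdef_matrix G"
  shows "det G > 0"
proof (rule ccontr)
  assume "\<not> det G > 0"
  define M where "M t = t *\<^sub>R G + (1 - t) *\<^sub>R mat 1" for t :: real
  have "continuous_on {0..1} (\<lambda>t. det (M t))"
    unfolding det_def M_def by (auto intro!: continuous_intros)
  moreover have "det (M 1) \<le> 0" "0 \<le> det (M 0)" using \<open>\<not> det G > 0\<close> by (auto simp: M_def)
  ultimately obtain t where t: "0 \<le> t" "t \<le> 1" "det (M t) = 0"
    using IVT2'[of "\<lambda>t. det (M t)" 1 0 0] by auto
  have "v \<bullet> (M t *v v) > 0" if "v \<noteq> 0" for v
  proof -
    have "v \<bullet> (M t *v v) = t * (v \<bullet> (G *v v)) + (1 - t) * (v \<bullet> v)"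
      by (simp add: M_def matrix_vector_mult_add_rdistrib inner_right_distrib scaleR_matrix_vector_assoc[symmetric])
    moreover have "v \<bullet> (G *v v) > 0" "v \<bullet> v > 0" using assms that by (auto simp: posdef_matrix_def)
    ultimately show ?thesis using t
      by (cases "t = 0") (auto intro!: add_pos_nonneg)
  qed
  moreover have "transpose (M t) = M t"
    using assms by (simp add: M_def posdef_matrix_def transpose_def vec_eq_iff mat_def)
  ultimately have "posdef_matrix (M t)" by (simp add: posdef_matrix_def)
  then have "M t ** matrix_inv (M t) = mat 1" by (rule posdef_matrix_inverse)
  then have "det (M t ** matrix_inv (M t)) = 1" by simp
  then show False using t(3) by (simp add: det_mul)
qed

lemma smooth_on_det:
  fixes G :: "'a::euclidean_space \<Rightarrow> real^'n^'n"
  assumes "open S" "\<And>i j. smooth_on S (\<lambda>x. G x $ i $ j)"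
  shows "smooth_on S (\<lambda>x. det (G x))"
  unfolding det_def
  by (intro smooth_on_sum smooth_on_mult smooth_on_prod smooth_on_const assms)

text \<open>This formula yields the smoothness of the inverse metric: its entries become quotients
  of determinants of smooth entries.\<close>

lemma matrix_inv_cramer:
  fixes A :: "real^'n^'n"
  assumes "A ** B = mat 1"
  shows "B $ i $ j = det (\<chi> k l. if l = i then mat 1 $ k $ j else A $ k $ l) / det A"
proof -
  have "det A \<noteq> 0" using arg_cong[OF assms, of det] by (auto simp: det_mul)
  moreover have "A *v column j B = column j (mat 1)"
    by (simp add: assms[symmetric] column_def matrix_vector_mult_def matrix_matrix_mult_def)
  ultimately have "column j B = (\<chi> k. det (\<chi> i' l. if l = k then column j (mat 1) $ i' else A $ i' $ l) / det A)"
    by (simp add: cramer)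
  then have "column j B $ i = det (\<chi> i' l. if l = i then column j (mat 1) $ i' else A $ i' $ l) / det A"
    by simp
  moreover have "(\<chi> i' l. if l = i then column j (mat 1) $ i' else A $ i' $ l)
      = (\<chi> k l. if l = i then mat 1 $ k $ j else A $ k $ l)"
    by (simp add: vec_eq_iff column_def)
  ultimately show ?thesis by (simp add: column_def)
qed

section \<open>Minkowski norms in the coordinates of a basis\<close>

locale minkowski_frame =
  fixes F :: "'a::euclidean_space \<Rightarrow> real" and b :: "'n::finite \<Rightarrow> 'a"
  assumes minkowski: "minkowski_space F" and basis: "vector_basis b"
begin

definition energy :: "'a \<Rightarrow> real" where "energy x = (F x)\<^sup>2 / 2"

abbreviation pd :: "'n \<Rightarrow> ('a \<Rightarrow> real) \<Rightarrow> 'a \<Rightarrow> real" where "pd i \<equiv> dir_deriv (b i)"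

definition metric :: "'a \<Rightarrow> real^'n^'n" where "metric x = (\<chi> i j. pd i (pd j energy) x)"

definition cometric :: "'a \<Rightarrow> real^'n^'n" where "cometric x = matrix_inv (metric x)"

lemma fundamental_tensor_energy: "fundamental_tensor F x u v = dir_deriv u (dir_deriv v energy) x"
  by (simp add: fundamental_tensor_def flat_hessian_def dir_deriv_def[abs_def] energy_def[abs_def])

lemma smooth_energy: "smooth_on punctured energy"
proof -
  have "smooth_on punctured (\<lambda>x. F x * F x * (1 / 2))"
    using minkowski unfolding minkowski_space_def
    by (intro smooth_on_mult smooth_on_const) auto
  then show ?thesis by (simp add: energy_def[abs_def] power2_eq_square)
qed

lemma fundamental_tensor_pos: "x \<noteq> 0 \<Longrightarrow> u \<noteq> 0 \<Longrightarrow> fundamental_tensor F x u u > 0"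
  using minkowski by (simp add: minkowski_space_def)

lemma energy_scale: "t > 0 \<Longrightarrow> energy (t *\<^sub>R x) = t ^ 2 * energy x"
  using minkowski by (simp add: minkowski_space_def energy_def power_mult_distrib)

lemma energy_euler: "x \<noteq> 0 \<Longrightarrow> dir_deriv x energy x = 2 * energy x"
  using dir_deriv_euler[of energy x 2] smooth_on_differentiable[OF smooth_energy] energy_scale by simp

text \<open>The first derivatives of the energy are 1-homogeneous, so Euler's relation applies to
  them. In coordinates it says that the metric at x maps the position vector x to the differential
  of the energy.\<close>

lemma energy_deriv_euler:
  assumes "x \<noteq> 0"
  shows "dir_deriv x (dir_deriv v energy) x = dir_deriv v energy x"
proof -
  have "dir_deriv v energy (t *\<^sub>R x) = t ^ 1 * dir_deriv v energy x" if "t > 0" for t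
    by (rule dir_deriv_homogeneous) (use smooth_energy energy_scale assms that in \<open>auto simp: power2_eq_square\<close>)
  then show ?thesis
    using dir_deriv_euler[of "dir_deriv v energy" x 1] assms
      smooth_on_differentiable[OF smooth_on_dir_deriv[OF smooth_energy]] by simp
qed

text \<open>By Euler's relation, used twice, the fundamental tensor at x takes the value
  \<open>2 * energy x\<close> on the pair (x, x), so definiteness gives the sign.\<close>

lemma energy_pos: "x \<noteq> 0 \<Longrightarrow> energy x > 0"
  using fundamental_tensor_pos[of x x] energy_deriv_euler[of x x] energy_euler[of x]
  by (simp add: fundamental_tensor_energy)

lemma norm_zero: "F 0 = 0"
proof -
  have "F (2 *\<^sub>R 0) = 2 * F 0" using minkowski unfolding minkowski_space_def by (metis zero_less_numeral)
  then show ?thesis by simp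
qed

lemma norm_pos: "x \<noteq> 0 \<Longrightarrow> F x > 0"
  using energy_pos[of x] minkowski unfolding energy_def minkowski_space_def
  by (metis less_eq_real_def less_irrefl power_zero_numeral div_0)

lemma energy_zero: "energy 0 = 0" by (simp add: energy_def norm_zero)

lemma continuous_energy: "continuous_on UNIV energy"
  using minkowski unfolding energy_def[abs_def] minkowski_space_def by (auto intro!: continuous_intros)

text \<open>The minimum over the unit sphere is positive, and 2-homogeneity spreads the bound.
  Sublevel sets of the energy are therefore bounded, which gives cutoffs in the energy a bounded
  support.\<close>

lemma energy_coercive:
  obtains m where "m > 0" "\<And>x. energy x \<ge> m * (norm x)\<^sup>2"
proof -
  have "compact (sphere (0::'a) 1)" "sphere (0::'a) 1 \<noteq> {}" by auto
  then obtain z :: 'a where z: "z \<in> sphere 0 1" "\<And>y. y \<in> sphere 0 1 \<Longrightarrow> energy z \<le> energy y"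
    using continuous_attains_inf[of "sphere (0::'a) 1" energy] continuous_on_subset[OF continuous_energy]
    by blast
  have "energy x \<ge> energy z * (norm x)\<^sup>2" for x
  proof (cases "x = 0")
    case False
    then have "energy x = (norm x)\<^sup>2 * energy (x /\<^sub>R norm x)"
      using energy_scale[of "norm x" "x /\<^sub>R norm x"] by simp
    moreover have "energy z \<le> energy (x /\<^sub>R norm x)" using False by (intro z) simp
    ultimately show ?thesis by (simp add: mult_left_mono mult.commute[of "energy z"])
  qed (simp add: energy_zero)
  moreover have "energy z > 0" using z(1) by (intro energy_pos) auto
  ultimately show thesis using that by blast
qed

lemma metric_posdef:
  assumes "x \<noteq> 0"
  shows "posdef_matrix (metric x)"
proof -
  have "transpose (metric x) = metric x"
    using dir_deriv_commute[OF open_punctured smooth_energy] assms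
    by (simp add: metric_def transpose_def vec_eq_iff)
  moreover have "v \<bullet> (metric x *v v) > 0" if "v \<noteq> 0" for v :: "real^'n"
  proof -
    define w where "w = (\<Sum>i\<in>UNIV. v $ i *\<^sub>R b i)"
    have "w \<noteq> 0" using that vector_basis_independent[OF basis, of "($) v"] by (auto simp: w_def vec_eq_iff)
    moreover have "fundamental_tensor F x w w = v \<bullet> (metric x *v v)"
      unfolding fundamental_tensor_energy w_def
      using assms by (subst dir_deriv_coords)
        (auto intro!: smooth_on_differentiable[of punctured] smooth_on_dir_deriv smooth_energy
          simp: dir_deriv_coords2[OF open_punctured smooth_energy] inner_vec_def matrix_vector_mult_def metric_def ac_simps)
    ultimately show ?thesis using fundamental_tensor_pos[OF assms, of w] by simp
  qed
  ultimately show ?thesis by (simp add: posdef_matrix_def)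
qed

lemma metric_cometric:
  assumes "x \<noteq> 0" shows "metric x ** cometric x = mat 1" "cometric x ** metric x = mat 1"
  using posdef_matrix_inverse[OF metric_posdef[OF assms]] by (auto simp: cometric_def)

lemma metric_sym: "x \<noteq> 0 \<Longrightarrow> metric x $ i $ j = metric x $ j $ i"
  using metric_posdef[of x] by (simp add: posdef_matrix_def transpose_def vec_eq_iff)

lemma cometric_sym:
  assumes "x \<noteq> 0" shows "cometric x $ i $ j = cometric x $ j $ i"
proof -
  have "transpose (cometric x) ** metric x = mat 1"
    using arg_cong[OF metric_cometric(1)[OF assms], of transpose] metric_posdef[OF assms]
    by (simp add: matrix_transpose_mul posdef_matrix_def)
  then have "transpose (cometric x) = cometric x"
    using metric_cometric(1)[OF assms] by (metis matrix_mul_assoc matrix_mul_lid matrix_mul_rid)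
  moreover have "cometric x $ i $ j = transpose (cometric x) $ j $ i" by (simp add: transpose_def)
  ultimately show ?thesis by simp
qed

lemma metric_det_pos: "x \<noteq> 0 \<Longrightarrow> det (metric x) > 0"
  by (intro posdef_matrix_det_pos metric_posdef)

lemma smooth_metric: "smooth_on punctured (\<lambda>x. metric x $ i $ j)"
  using smooth_on_dir_deriv[OF smooth_on_dir_deriv[OF smooth_energy]] by (simp add: metric_def)

lemma smooth_metric_det: "smooth_on punctured (\<lambda>x. det (metric x))"
  by (intro smooth_on_det smooth_metric open_punctured)

lemma smooth_cometric: "smooth_on punctured (\<lambda>x. cometric x $ i $ j)"
proof -
  have "smooth_on punctured (\<lambda>x. det (\<chi> k l. if l = i then mat 1 $ k $ j else metric x $ k $ l) * inverse (det (metric x)))"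
  proof (intro smooth_on_mult smooth_on_inverse smooth_metric_det smooth_on_det open_punctured)
    show "smooth_on punctured (\<lambda>x. (\<chi> k l. if l = i then mat 1 $ k $ j else metric x $ k $ l) $ k $ l)" for k l
      by (cases "l = i") (auto simp: smooth_on_const smooth_metric)
  qed (use metric_det_pos in \<open>auto simp: order_less_imp_not_eq2\<close>)
  then show ?thesis
    by (subst smooth_on_cong[OF open_punctured])
       (use matrix_inv_cramer[OF metric_cometric(1)] in \<open>auto simp: divide_inverse\<close>)
qed

section \<open>Third derivatives of the energy and the Cartan form\<close>

definition third :: "'n \<Rightarrow> 'n \<Rightarrow> 'n \<Rightarrow> 'a \<Rightarrow> real" where
  "third p q k = pd k (pd p (pd q energy))"

lemma third_metric: "third p q k x = dir_deriv (b k) (\<lambda>y. metric y $ p $ q) x"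
  by (simp add: third_def metric_def)

text \<open>Exchanging the inner two derivatives gives this symmetry, exchanging the outer two gives
  \<open>third_swap13\<close>; together they generate all permutations of the indices.\<close>

lemma third_swap12: "x \<noteq> 0 \<Longrightarrow> third p q k x = third q p k x"
  unfolding third_metric by (rule dir_deriv_cong_open[of punctured]) (auto intro: metric_sym)

lemma third_swap13: "x \<noteq> 0 \<Longrightarrow> third p q k x = third k q p x"
  unfolding third_def
  by (rule dir_deriv_commute[OF open_punctured]) (auto intro: smooth_on_dir_deriv smooth_energy)

lemma third_swap23: "x \<noteq> 0 \<Longrightarrow> third p q k x = third p k q x"
  using third_swap12 third_swap13 by metis

lemma metric_det_deriv:
  assumes "x \<noteq> 0"
  shows "pd k (\<lambda>y. det (metric y)) x = det (metric x) * (\<Sum>p\<in>UNIV. \<Sum>q\<in>UNIV. cometric x $ p $ q * third q p k x)"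
proof -
  have "((\<lambda>y. det (metric y)) has_derivative (\<lambda>v. det (metric x) * trace (cometric x ** (\<chi> i j. dir_deriv v (\<lambda>y. metric y $ i $ j) x)))) (at x)"
    by (rule det_has_derivative)
       (use assms metric_cometric smooth_on_has_derivative[OF smooth_metric] in auto)
  from dir_derivI[OF this, of "b k"] show ?thesis
    by (simp add: third_metric trace_def matrix_matrix_mult_def)
qed

lemma volume_ratio_metric: "volume_ratio b F y = sqrt (det (metric y))"
  by (simp add: volume_ratio_def metric_def fundamental_tensor_energy)

lemma ln_volume_ratio_has_derivative:
  assumes "x \<noteq> 0"
  shows "((\<lambda>y. ln (volume_ratio b F y)) has_derivative
      (\<lambda>v. dir_deriv v (\<lambda>y. det (metric y)) x / (2 * det (metric x)))) (at x)"
proof -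
  have "((\<lambda>y. det (metric y)) has_derivative (\<lambda>v. dir_deriv v (\<lambda>y. det (metric y)) x)) (at x)"
    using smooth_on_has_derivative[OF smooth_metric_det] assms by auto
  then show ?thesis
    unfolding volume_ratio_metric using metric_det_pos[OF assms]
    by (auto intro!: derivative_eq_intros simp: field_simps)
qed

text \<open>Jacobi's formula, with the factor 1/2 from the square root in
  \<open>volume_ratio\<close>. As a trace of third derivatives, the Cartan form becomes comparable
  with the second derivatives of f.\<close>

lemma cartan_form_pd:
  assumes "x \<noteq> 0"
  shows "cartan_form b F x (b k) = (\<Sum>p\<in>UNIV. \<Sum>q\<in>UNIV. cometric x $ p $ q * third q p k x) / 2"
  using dir_derivI[OF ln_volume_ratio_has_derivative[OF assms], of "b k"] metric_det_pos[OF assms]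
  by (simp add: cartan_form_def dir_deriv_def[symmetric] metric_det_deriv[OF assms])

end

subsection \<open>The divergence identity\<close>

lemma sum_reverse3: "(\<Sum>i\<in>A. \<Sum>j\<in>B. \<Sum>k\<in>C. f i j k) = (\<Sum>k\<in>C. \<Sum>j\<in>B. \<Sum>i\<in>A. f i j k)"
proof -
  have "(\<Sum>i\<in>A. \<Sum>j\<in>B. \<Sum>k\<in>C. f i j k) = (\<Sum>i\<in>A. \<Sum>k\<in>C. \<Sum>j\<in>B. f i j k)"
    by (rule sum.cong[OF refl], rule sum.swap)
  also have "\<dots> = (\<Sum>k\<in>C. \<Sum>i\<in>A. \<Sum>j\<in>B. f i j k)" by (rule sum.swap)
  also have "\<dots> = (\<Sum>k\<in>C. \<Sum>j\<in>B. \<Sum>i\<in>A. f i j k)" by (rule sum.cong[OF refl], rule sum.swap)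
  finally show ?thesis .
qed

lemma sum_rotate3: "(\<Sum>i\<in>A. \<Sum>j\<in>B. \<Sum>k\<in>C. f i j k) = (\<Sum>j\<in>B. \<Sum>k\<in>C. \<Sum>i\<in>A. f i j k)"
proof -
  have "(\<Sum>i\<in>A. \<Sum>j\<in>B. \<Sum>k\<in>C. f i j k) = (\<Sum>j\<in>B. \<Sum>i\<in>A. \<Sum>k\<in>C. f i j k)" by (rule sum.swap)
  also have "\<dots> = (\<Sum>j\<in>B. \<Sum>k\<in>C. \<Sum>i\<in>A. f i j k)" by (rule sum.cong[OF refl], rule sum.swap)
  finally show ?thesis .
qed

context minkowski_frame
begin

lemma pd_mult:
  "smooth_on punctured f \<Longrightarrow> smooth_on punctured g \<Longrightarrow> x \<noteq> 0 \<Longrightarrow>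
    pd i (\<lambda>y. f y * g y) x = pd i f x * g x + f x * pd i g x"
  by (intro dir_deriv_mult smooth_on_differentiable[of punctured]) auto

lemma pd_sum:
  "(\<And>j. j \<in> J \<Longrightarrow> smooth_on punctured (f j)) \<Longrightarrow> x \<noteq> 0 \<Longrightarrow>
    pd i (\<lambda>y. \<Sum>j\<in>J. f j y) x = (\<Sum>j\<in>J. pd i (f j) x)"
  by (intro dir_deriv_sum smooth_on_differentiable[of punctured]) auto

lemmas smooth_intros =
  smooth_on_sum[OF open_punctured] smooth_on_mult[OF open_punctured] smooth_on_dir_deriv
  smooth_energy smooth_metric smooth_cometric smooth_metric_det

text \<open>The product of \<open>cometric\<close> and \<open>metric\<close> is constantly
  \<open>mat 1\<close>; differentiating it gives dH = - H dG H.\<close>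

lemma cometric_deriv:
  assumes "x \<noteq> 0"
  shows "pd k (\<lambda>y. cometric y $ i $ j) x =
    - (\<Sum>p\<in>UNIV. \<Sum>q\<in>UNIV. cometric x $ i $ p * third p q k x * cometric x $ q $ j)"
proof -
  define dH dG :: "real^'n^'n" where "dH = (\<chi> i j. pd k (\<lambda>y. cometric y $ i $ j) x)"
    and "dG = (\<chi> i j. third i j k x)"
  have "dH ** metric x + cometric x ** dG = 0"
  proof -
    have "(\<Sum>l\<in>UNIV. dH $ i $ l * metric x $ l $ j + cometric x $ i $ l * dG $ l $ j) = 0" for i j
    proof -
      have "(\<Sum>l\<in>UNIV. dH $ i $ l * metric x $ l $ j + cometric x $ i $ l * dG $ l $ j)
          = pd k (\<lambda>y. \<Sum>l\<in>UNIV. cometric y $ i $ l * metric y $ l $ j) x"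
        by (subst pd_sum) (auto simp: assms pd_mult smooth_intros third_metric dH_def dG_def)
      also have "\<dots> = pd k (\<lambda>y. mat 1 $ i $ j) x"
      proof (rule dir_deriv_cong_open[OF open_punctured])
        fix y :: 'a assume "y \<in> punctured"
        then have "(cometric y ** metric y) $ i $ j = mat 1 $ i $ j" by (simp add: metric_cometric)
        then show "(\<Sum>l\<in>UNIV. cometric y $ i $ l * metric y $ l $ j) = mat 1 $ i $ j"
          by (simp add: matrix_matrix_mult_def)
      qed (use assms in simp)
      also have "\<dots> = 0" by (simp add: dir_deriv_def)
      finally show ?thesis .
    qed
    then show ?thesis by (simp add: vec_eq_iff matrix_matrix_mult_def sum.distrib)
  qed
  then have "dH ** metric x ** cometric x = - (cometric x ** dG) ** cometric x"
    by (simp add: add_eq_0_iff2)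
  then have "dH = - (cometric x ** dG) ** cometric x"
    by (simp add: matrix_mul_assoc[symmetric] metric_cometric assms)
  then have "dH $ i $ j = - ((cometric x ** dG ** cometric x) $ i $ j)"
    by (simp add: matrix_matrix_mult_def sum_negf)
  also have "(cometric x ** dG ** cometric x) $ i $ j =
      (\<Sum>q\<in>UNIV. \<Sum>p\<in>UNIV. cometric x $ i $ p * third p q k x * cometric x $ q $ j)"
    by (simp add: matrix_matrix_mult_def dG_def sum_distrib_right)
  also have "\<dots> = (\<Sum>p\<in>UNIV. \<Sum>q\<in>UNIV. cometric x $ i $ p * third p q k x * cometric x $ q $ j)"
    by (rule sum.swap)
  finally show ?thesis by (simp add: dH_def)
qed

text \<open>Piola's identity: the matrix is the cofactor matrix of the Jacobian matrix of the
  differential of the energy. Jacobi's formula and the derivative of the inverse produce two sums,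
  which cancel by the total symmetry of \<open>third\<close>.\<close>

lemma det_cometric_divergence:
  assumes "x \<noteq> 0"
  shows "(\<Sum>i\<in>UNIV. pd i (\<lambda>y. det (metric y) * cometric y $ i $ a) x) = 0"
proof -
  let ?H = "cometric x"
  have e: "?H $ i $ p * third p q i x * ?H $ q $ a = ?H $ p $ i * third i p q x * ?H $ q $ a" for i p q
    using cometric_sym[OF assms, of i p] third_swap13[OF assms, of p q i] third_swap23[OF assms, of i q p] by simp
  have "(\<Sum>i\<in>UNIV. pd i (\<lambda>y. det (metric y) * cometric y $ i $ a) x)
      = det (metric x) * ((\<Sum>i\<in>UNIV. \<Sum>p\<in>UNIV. \<Sum>q\<in>UNIV. ?H $ p $ q * third q p i x * ?H $ i $ a)
         - (\<Sum>i\<in>UNIV. \<Sum>p\<in>UNIV. \<Sum>q\<in>UNIV. ?H $ i $ p * third p q i x * ?H $ q $ a))"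
    by (simp add: pd_mult smooth_intros assms metric_det_deriv cometric_deriv sum_distrib_left sum_distrib_right
        sum_subtractf right_diff_distrib mult.assoc)
  also have "(\<Sum>i\<in>UNIV. \<Sum>p\<in>UNIV. \<Sum>q\<in>UNIV. ?H $ i $ p * third p q i x * ?H $ q $ a)
      = (\<Sum>q\<in>UNIV. \<Sum>p\<in>UNIV. \<Sum>i\<in>UNIV. ?H $ i $ p * third p q i x * ?H $ q $ a)"
    by (rule sum_reverse3)
  also have "\<dots> = (\<Sum>q\<in>UNIV. \<Sum>p\<in>UNIV. \<Sum>i\<in>UNIV. ?H $ p $ i * third i p q x * ?H $ q $ a)"
    by (intro sum.cong refl e)
  finally show ?thesis by simp
qed

section \<open>The field W and its divergence\<close>

definition grad :: "('a \<Rightarrow> real) \<Rightarrow> 'n \<Rightarrow> 'a \<Rightarrow> real" where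
  "grad u k x = (\<Sum>j\<in>UNIV. cometric x $ k $ j * pd j u x)"

definition hess_grad :: "('a \<Rightarrow> real) \<Rightarrow> 'n \<Rightarrow> 'a \<Rightarrow> real" where
  "hess_grad u a x = (\<Sum>k\<in>UNIV. pd a (pd k u) x * grad u k x)"

text \<open>This is the field W. The determinant and \<open>cometric\<close> are kept together
  because it is their product that has zero divergence.\<close>

definition flux :: "('a \<Rightarrow> real) \<Rightarrow> 'n \<Rightarrow> 'a \<Rightarrow> real" where
  "flux u i x = (\<Sum>a\<in>UNIV. (det (metric x) * cometric x $ i $ a) * hess_grad u a x)"

lemma smooth_grad: "smooth_on punctured u \<Longrightarrow> smooth_on punctured (grad u k)"
  unfolding grad_def[abs_def] by (intro smooth_intros)

lemma smooth_hess_grad: "smooth_on punctured u \<Longrightarrow> smooth_on punctured (hess_grad u k)"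
  unfolding hess_grad_def[abs_def] by (intro smooth_intros smooth_grad)

lemma smooth_flux: "smooth_on punctured u \<Longrightarrow> smooth_on punctured (flux u k)"
  unfolding flux_def[abs_def] by (intro smooth_intros smooth_hess_grad)

text \<open>The bracket is the Hessian of u for the connection that is flat in the dual coordinates,
  the components of the differential of the energy; \<open>grad u\<close> consists of the partial
  derivatives of u in these coordinates.\<close>

lemma grad_deriv:
  assumes "smooth_on punctured u" "x \<noteq> 0"
  shows "pd i (grad u k) x =
    (\<Sum>j\<in>UNIV. cometric x $ k $ j * (pd i (pd j u) x - (\<Sum>q\<in>UNIV. third j q i x * grad u q x)))"
proof -
  let ?H = "cometric x"
  have "pd i (grad u k) x = (\<Sum>j\<in>UNIV. pd i (\<lambda>y. cometric y $ k $ j) x * pd j u x + ?H $ k $ j * pd i (pd j u) x)"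
    unfolding grad_def[abs_def] by (subst pd_sum) (auto simp: pd_mult smooth_intros assms)
  also have "\<dots> = (\<Sum>j\<in>UNIV. ?H $ k $ j * pd i (pd j u) x)
      - (\<Sum>j\<in>UNIV. \<Sum>p\<in>UNIV. \<Sum>q\<in>UNIV. ?H $ k $ p * third p q i x * ?H $ q $ j * pd j u x)"
    by (simp add: sum.distrib cometric_deriv assms sum_distrib_right sum_negf sum_subtractf)
  also have "(\<Sum>j\<in>UNIV. \<Sum>p\<in>UNIV. \<Sum>q\<in>UNIV. ?H $ k $ p * third p q i x * ?H $ q $ j * pd j u x)
      = (\<Sum>p\<in>UNIV. \<Sum>q\<in>UNIV. \<Sum>j\<in>UNIV. ?H $ k $ p * third p q i x * ?H $ q $ j * pd j u x)"
    by (rule sum_rotate3)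
  also have "\<dots> = (\<Sum>p\<in>UNIV. ?H $ k $ p * (\<Sum>q\<in>UNIV. third p q i x * grad u q x))"
    by (simp add: grad_def sum_distrib_left mult.assoc)
  finally show ?thesis by (simp add: right_diff_distrib sum_subtractf)
qed

text \<open>The trace of the flat Hessian in the metric; in general this differs from the
  Laplace-Beltrami operator by a first-order term.\<close>

definition harmonic :: "('a \<Rightarrow> real) \<Rightarrow> bool" where
  "harmonic u \<longleftrightarrow> (\<forall>x. x \<noteq> 0 \<longrightarrow> (\<Sum>i\<in>UNIV. \<Sum>a\<in>UNIV. cometric x $ i $ a * pd i (pd a u) x) = 0)"

text \<open>The equation of \<open>harmonic\<close> is differentiated in the direction k, and the
  derivative of \<open>cometric\<close> gives the right side. This removes the third derivatives of
  u from the divergence of \<open>flux\<close>.\<close>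

lemma harmonic_deriv:
  assumes "smooth_on punctured u" "harmonic u" "x \<noteq> 0"
  shows "(\<Sum>i\<in>UNIV. \<Sum>a\<in>UNIV. cometric x $ i $ a * pd k (pd i (pd a u)) x) =
    (\<Sum>p\<in>UNIV. \<Sum>q\<in>UNIV. third p q k x *
      (\<Sum>i\<in>UNIV. \<Sum>a\<in>UNIV. cometric x $ p $ i * pd i (pd a u) x * cometric x $ a $ q))"
proof -
  let ?H = "cometric x" and ?u = "\<lambda>i a. pd i (pd a u) x"
  have e: "?H $ i $ p * third p q k x * ?H $ q $ a * ?u i a = third p q k x * (?H $ p $ i * ?u i a * ?H $ a $ q)"
    for i p q a
    using cometric_sym[OF assms(3), of i p] cometric_sym[OF assms(3), of q a] by simp
  have "0 = pd k (\<lambda>y. 0) x" by (simp add: dir_deriv_def)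
  also have "\<dots> = pd k (\<lambda>y. \<Sum>i\<in>UNIV. \<Sum>a\<in>UNIV. cometric y $ i $ a * pd i (pd a u) y) x"
    by (rule dir_deriv_cong_open[OF open_punctured]) (use assms in \<open>auto simp: harmonic_def\<close>)
  also have "\<dots> = (\<Sum>i\<in>UNIV. \<Sum>a\<in>UNIV. pd k (\<lambda>y. cometric y $ i $ a) x * ?u i a + ?H $ i $ a * pd k (pd i (pd a u)) x)"
    using assms by (simp add: pd_sum pd_mult smooth_intros)
  finally have "(\<Sum>i\<in>UNIV. \<Sum>a\<in>UNIV. ?H $ i $ a * pd k (pd i (pd a u)) x)
      = (\<Sum>i\<in>UNIV. \<Sum>a\<in>UNIV. \<Sum>p\<in>UNIV. \<Sum>q\<in>UNIV. ?H $ i $ p * third p q k x * ?H $ q $ a * ?u i a)"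
    by (simp add: sum.distrib cometric_deriv assms sum_distrib_right sum_negf sum_subtractf)
  also have "\<dots> = (\<Sum>i\<in>UNIV. \<Sum>p\<in>UNIV. \<Sum>q\<in>UNIV. \<Sum>a\<in>UNIV. ?H $ i $ p * third p q k x * ?H $ q $ a * ?u i a)"
    by (rule sum.cong[OF refl], rule sum_rotate3)
  also have "\<dots> = (\<Sum>p\<in>UNIV. \<Sum>q\<in>UNIV. \<Sum>i\<in>UNIV. \<Sum>a\<in>UNIV. ?H $ i $ p * third p q k x * ?H $ q $ a * ?u i a)"
    by (rule sum_rotate3)
  also have "\<dots> = (\<Sum>p\<in>UNIV. \<Sum>q\<in>UNIV. \<Sum>i\<in>UNIV. \<Sum>a\<in>UNIV. third p q k x * (?H $ p $ i * ?u i a * ?H $ a $ q))"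
    by (intro sum.cong refl e)
  finally show ?thesis by (simp add: sum_distrib_left)
qed

text \<open>The derivatives of the determinant times \<open>cometric\<close> contribute nothing, by
  Piola's identity. The third derivatives of u and the derivative of \<open>cometric\<close> inside
  \<open>grad\<close> reduce to the same contraction of \<open>third\<close> with opposite signs, so
  the square of the Hessian remains.\<close>

lemma flux_divergence:
  assumes u: "smooth_on punctured u" and "harmonic u" and x: "x \<noteq> 0"
  shows "(\<Sum>i\<in>UNIV. pd i (flux u i) x) = det (metric x) *
    (\<Sum>i\<in>UNIV. \<Sum>a\<in>UNIV. \<Sum>k\<in>UNIV. \<Sum>j\<in>UNIV.
      cometric x $ i $ a * cometric x $ k $ j * (pd a (pd k u) x * pd i (pd j u) x))"
proof -
  let ?H = "cometric x" and ?u = "\<lambda>i a. pd i (pd a u) x" and ?D = "det (metric x)" and ?p = "\<lambda>k. grad u k x"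
  \<comment> \<open>The Hessian of u with both indices raised; the two sums that cancel are both
    brought to a contraction of \<open>third\<close> with \<open>?E\<close>.\<close>
  let ?E = "\<lambda>p q. \<Sum>i\<in>UNIV. \<Sum>a\<in>UNIV. ?H $ p $ i * ?u i a * ?H $ a $ q"
  have "(\<Sum>i\<in>UNIV. pd i (flux u i) x) =
      (\<Sum>i\<in>UNIV. \<Sum>a\<in>UNIV. pd i (\<lambda>y. det (metric y) * cometric y $ i $ a) x * hess_grad u a x
        + ?D * ?H $ i $ a * pd i (hess_grad u a) x)"
    unfolding flux_def[abs_def] using x
    by (intro sum.cong refl, subst pd_sum, (intro smooth_intros smooth_hess_grad u, assumption),
        (intro sum.cong refl, subst pd_mult, auto intro!: smooth_intros smooth_hess_grad u))
  also have "\<dots> = (\<Sum>a\<in>UNIV. \<Sum>i\<in>UNIV. pd i (\<lambda>y. det (metric y) * cometric y $ i $ a) x * hess_grad u a x)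
      + (\<Sum>i\<in>UNIV. \<Sum>a\<in>UNIV. ?D * ?H $ i $ a * pd i (hess_grad u a) x)"
    unfolding sum.distrib by (subst sum.swap) (rule refl)
  also have "(\<Sum>a\<in>UNIV. \<Sum>i\<in>UNIV. pd i (\<lambda>y. det (metric y) * cometric y $ i $ a) x * hess_grad u a x) = 0"
    unfolding sum_distrib_right[symmetric] by (simp add: det_cometric_divergence[OF x])
  finally have 1: "(\<Sum>i\<in>UNIV. pd i (flux u i) x) = ?D * (\<Sum>i\<in>UNIV. \<Sum>a\<in>UNIV. ?H $ i $ a * pd i (hess_grad u a) x)"
    by (simp add: sum_distrib_left mult.assoc)
  have d: "pd i (hess_grad u a) x = (\<Sum>k\<in>UNIV. pd i (pd a (pd k u)) x * ?p k)
      + (\<Sum>k\<in>UNIV. \<Sum>j\<in>UNIV. ?H $ k $ j * (?u a k * ?u i j))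
      - (\<Sum>k\<in>UNIV. \<Sum>j\<in>UNIV. \<Sum>q\<in>UNIV. ?u a k * ?H $ k $ j * (third j q i x * ?p q))" for i a
  proof -
    have "pd i (hess_grad u a) x = (\<Sum>k\<in>UNIV. pd i (pd a (pd k u)) x * ?p k + ?u a k * pd i (grad u k) x)"
      unfolding hess_grad_def[abs_def] using x
      by (subst pd_sum) (auto intro!: smooth_intros smooth_grad u sum.cong pd_mult)
    then show ?thesis
      by (simp add: grad_deriv[OF u x] sum.distrib right_diff_distrib sum_subtractf sum_distrib_left mult.assoc mult.left_commute)
  qed
  have "(\<Sum>i\<in>UNIV. \<Sum>a\<in>UNIV. ?H $ i $ a * pd i (hess_grad u a) x)
      = (\<Sum>i\<in>UNIV. \<Sum>a\<in>UNIV. \<Sum>k\<in>UNIV. ?H $ i $ a * pd i (pd a (pd k u)) x * ?p k)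
      + (\<Sum>i\<in>UNIV. \<Sum>a\<in>UNIV. \<Sum>k\<in>UNIV. \<Sum>j\<in>UNIV. ?H $ i $ a * ?H $ k $ j * (?u a k * ?u i j))
      - (\<Sum>i\<in>UNIV. \<Sum>a\<in>UNIV. \<Sum>k\<in>UNIV. \<Sum>j\<in>UNIV. \<Sum>q\<in>UNIV. ?H $ i $ a * ?u a k * ?H $ k $ j * (third j q i x * ?p q))"
    unfolding d by (simp add: sum.distrib distrib_left right_diff_distrib sum_subtractf sum_distrib_left mult.assoc)
  also have "(\<Sum>i\<in>UNIV. \<Sum>a\<in>UNIV. \<Sum>k\<in>UNIV. ?H $ i $ a * pd i (pd a (pd k u)) x * ?p k)
      = (\<Sum>k\<in>UNIV. ?p k * (\<Sum>p\<in>UNIV. \<Sum>q\<in>UNIV. third p q k x * ?E p q))"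
  proof -
    have c: "pd i (pd a (pd k u)) x = pd k (pd i (pd a u)) x" for i a k
    proof -
      have "pd i (pd a (pd k u)) x = pd i (pd k (pd a u)) x"
        using x u by (intro dir_deriv_cong_open[OF open_punctured]) (auto intro: dir_deriv_commute[OF open_punctured])
      also have "\<dots> = pd k (pd i (pd a u)) x"
        using x u by (intro dir_deriv_commute[OF open_punctured]) (auto intro: smooth_intros)
      finally show ?thesis .
    qed
    have "(\<Sum>i\<in>UNIV. \<Sum>a\<in>UNIV. \<Sum>k\<in>UNIV. ?H $ i $ a * pd i (pd a (pd k u)) x * ?p k)
        = (\<Sum>i\<in>UNIV. \<Sum>a\<in>UNIV. \<Sum>k\<in>UNIV. ?H $ i $ a * pd k (pd i (pd a u)) x * ?p k)"
      by (intro sum.cong refl arg_cong2[where f="(*)"] c)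
    also have "\<dots> = (\<Sum>k\<in>UNIV. \<Sum>i\<in>UNIV. \<Sum>a\<in>UNIV. ?H $ i $ a * pd k (pd i (pd a u)) x * ?p k)"
      by (rule sum_rotate3[symmetric])
    also have "\<dots> = (\<Sum>k\<in>UNIV. ?p k * (\<Sum>i\<in>UNIV. \<Sum>a\<in>UNIV. ?H $ i $ a * pd k (pd i (pd a u)) x))"
      by (simp add: sum_distrib_left mult.commute)
    finally show ?thesis unfolding harmonic_deriv[OF assms] .
  qed
  also have "(\<Sum>i\<in>UNIV. \<Sum>a\<in>UNIV. \<Sum>k\<in>UNIV. \<Sum>j\<in>UNIV. \<Sum>q\<in>UNIV. ?H $ i $ a * ?u a k * ?H $ k $ j * (third j q i x * ?p q))
      = (\<Sum>k\<in>UNIV. ?p k * (\<Sum>p\<in>UNIV. \<Sum>q\<in>UNIV. third p q k x * ?E p q))"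
  proof -
    have t: "third j q i x = third i j q x" for i j q
      using third_swap13[OF x, of j q i] third_swap23[OF x, of i q j] by simp
    have "(\<Sum>i\<in>UNIV. \<Sum>a\<in>UNIV. \<Sum>k\<in>UNIV. \<Sum>j\<in>UNIV. \<Sum>q\<in>UNIV. ?H $ i $ a * ?u a k * ?H $ k $ j * (third j q i x * ?p q))
      = (\<Sum>i\<in>UNIV. \<Sum>j\<in>UNIV. \<Sum>a\<in>UNIV. \<Sum>k\<in>UNIV. \<Sum>q\<in>UNIV. ?H $ i $ a * ?u a k * ?H $ k $ j * (third j q i x * ?p q))"
      by (rule sum.cong[OF refl], rule sum_rotate3[symmetric])
    also have "\<dots> = (\<Sum>i\<in>UNIV. \<Sum>j\<in>UNIV. \<Sum>q\<in>UNIV. \<Sum>a\<in>UNIV. \<Sum>k\<in>UNIV. ?H $ i $ a * ?u a k * ?H $ k $ j * (third j q i x * ?p q))"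
      by (rule sum.cong[OF refl], rule sum.cong[OF refl], rule sum_rotate3[symmetric])
    also have "\<dots> = (\<Sum>i\<in>UNIV. \<Sum>j\<in>UNIV. \<Sum>q\<in>UNIV. ?E i j * (third j q i x * ?p q))"
      by (simp add: sum_distrib_right)
    also have "\<dots> = (\<Sum>q\<in>UNIV. \<Sum>i\<in>UNIV. \<Sum>j\<in>UNIV. ?E i j * (third j q i x * ?p q))"
      by (rule sum_rotate3[symmetric])
    also have "\<dots> = (\<Sum>q\<in>UNIV. \<Sum>i\<in>UNIV. \<Sum>j\<in>UNIV. ?p q * (third i j q x * ?E i j))"
      by (intro sum.cong refl) (subst t, rule mult.left_commute[THEN trans], simp)
    finally show ?thesis by (simp only: sum_distrib_left)
  qed
  finally show ?thesis unfolding 1 by simp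
qed

end

subsection \<open>Linearity of homogeneous harmonic functions\<close>

text \<open>Squaring makes the positive part continuously differentiable, and one continuous
  derivative is the regularity that the integration of derivatives asks of a cutoff.\<close>

lemma DERIV_max_0_squared: "((\<lambda>r::real. (max 0 r)\<^sup>2) has_real_derivative 2 * max 0 r) (at r)"
proof -
  consider "r < 0" | "r > 0" | "r = 0" by linarith
  then show ?thesis
  proof cases
    case 1
    have "((\<lambda>r::real. 0) has_real_derivative 2 * max 0 r) (at r)" using 1 by simp
    then show ?thesis
      by (rule has_field_derivative_transform_within_open[of _ _ _ "{..<0}"]) (use 1 in auto)
  next
    case 2
    have "((\<lambda>r::real. r\<^sup>2) has_real_derivative 2 * max 0 r) (at r)"
      using 2 by (auto intro!: derivative_eq_intros)
    then show ?thesis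
      by (rule has_field_derivative_transform_within_open[of _ _ _ "{0<..}"]) (use 2 in auto)
  next
    case 3
    have "((\<lambda>h::real. (max 0 h)\<^sup>2 / h) \<longlongrightarrow> 0) (at 0)"
    proof (rule Lim_null_comparison)
      show "\<forall>\<^sub>F h in at 0. norm ((max 0 h)\<^sup>2 / h) \<le> \<bar>h\<bar>" for h :: real
        by (rule always_eventually) (auto simp: max_def power2_eq_square)
      show "((\<lambda>h::real. \<bar>h\<bar>) \<longlongrightarrow> 0) (at 0)" by (intro tendsto_rabs_zero) auto
    qed
    then show ?thesis using 3 by (simp add: DERIV_def)
  qed
qed

lemma C1_bump_exists:
  fixes s :: real
  assumes "s > 0"
  obtains \<psi> \<psi>' a c where "\<And>r. (\<psi> has_real_derivative \<psi>' r) (at r)" "continuous_on UNIV \<psi>'"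
    "0 < a" "0 < c" "\<forall>r\<le>a. \<psi> r = 0" "\<forall>r\<ge>c. \<psi> r = 0" "\<And>r. \<psi> r \<ge> 0" "\<psi> s > 0"
proof
  \<comment> \<open>A quadratic polynomial that is positive exactly between \<open>s / 2\<close> and
    \<open>2 * s\<close>, an interval around s; its derivative is
    \<open>5 / 2 * s - 2 * r\<close>.\<close>
  define q where "q r = (r - s / 2) * (2 * s - r)" for r
  have "((\<lambda>r. (max 0 (q r))\<^sup>2) has_real_derivative 2 * max 0 (q r) * (5 / 2 * s - 2 * r)) (at r)" for r
  proof -
    have "(q has_real_derivative (5 / 2 * s - 2 * r)) (at r)"
      unfolding q_def[abs_def] by (auto intro!: derivative_eq_intros simp: field_simps)
    from DERIV_chain2[OF DERIV_max_0_squared this] show ?thesis by simp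
  qed
  then show "((\<lambda>r. (max 0 (q r))\<^sup>2) has_real_derivative (\<lambda>r. 2 * max 0 (q r) * (5 / 2 * s - 2 * r)) r) (at r)" for r .
  show "continuous_on UNIV (\<lambda>r. 2 * max 0 (q r) * (5 / 2 * s - 2 * r))"
    unfolding q_def by (intro continuous_intros)
  show "0 < s / 2" "0 < 2 * s" using assms by auto
  have "q r \<le> 0" if "r \<le> s / 2" for r
    unfolding q_def using that assms by (intro mult_nonpos_nonneg) auto
  then show "\<forall>r\<le>s / 2. (max 0 (q r))\<^sup>2 = 0" by (simp add: max_absorb1)
  have "q r \<le> 0" if "2 * s \<le> r" for r
    unfolding q_def using that assms by (intro mult_nonneg_nonpos) auto
  then show "\<forall>r\<ge>2 * s. (max 0 (q r))\<^sup>2 = 0" by (simp add: max_absorb1)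
  show "(max 0 (q r))\<^sup>2 \<ge> 0" for r by simp
  show "(max 0 (q s))\<^sup>2 > 0" using assms by (auto simp: q_def max_def)
qed

context minkowski_frame
begin

text \<open>The function w is uncontrolled at 0, but h vanishes on the neighbourhood N of 0 where
  the energy is below a. Regularity is therefore checked separately on N and on the punctured space,
  two open sets that cover everything.\<close>

lemma cutoff_properties:
  assumes \<psi>: "\<And>r. (\<psi> has_real_derivative \<psi>' r) (at r)" "continuous_on UNIV \<psi>'"
    and a: "0 < a" "\<forall>r\<le>a. \<psi> r = 0"
    and c: "0 < c" "\<forall>r\<ge>c. \<psi> r = 0"
    and w: "smooth_on punctured w"
  defines "h \<equiv> \<lambda>x. \<psi> (energy x) * w x"
  shows "h differentiable at x"
    and "x \<noteq> 0 \<Longrightarrow> dir_deriv v h x = \<psi>' (energy x) * dir_deriv v energy x * w x + \<psi> (energy x) * dir_deriv v w x"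
    and "dir_deriv v h 0 = 0"
    and "continuous_on UNIV (dir_deriv v h)"
    and "\<exists>R. \<forall>x. norm x > R \<longrightarrow> h x = 0"
proof -
  define N where "N = {x. energy x < a}"
  have N: "open N" "0 \<in> N"
    using a(1) continuous_energy by (auto simp: N_def energy_zero intro!: open_Collect_less)
  have h0: "h y = 0" if "y \<in> N" for y using that a(2) by (simp add: N_def h_def)
  have dN: "(h has_derivative (\<lambda>v. 0)) (at y)" if "y \<in> N" for y
    using has_derivative_cong_open[OF N(1) that, of h "\<lambda>_. 0"] h0 by simp
  have dP: "(h has_derivative (\<lambda>v. \<psi>' (energy y) * dir_deriv v energy y * w y + \<psi> (energy y) * dir_deriv v w y)) (at y)"
    if "y \<noteq> 0" for y
  proof -
    have "((\<lambda>x. \<psi> (energy x)) has_derivative (\<lambda>v. \<psi>' (energy y) * dir_deriv v energy y)) (at y)"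
      using has_derivative_compose[OF smooth_on_has_derivative[OF smooth_energy] \<psi>(1)[unfolded has_field_derivative_def]] that
      by simp
    from has_derivative_mult[OF this smooth_on_has_derivative[OF w]] that show ?thesis
      unfolding h_def by (simp add: add.commute mult.assoc)
  qed
  show "h differentiable at x"
    using dN[OF N(2)] dP[of x] by (cases "x = 0") (auto simp: differentiable_def)
  show f: "dir_deriv v h x = \<psi>' (energy x) * dir_deriv v energy x * w x + \<psi> (energy x) * dir_deriv v w x" if "x \<noteq> 0" for x
    by (rule dir_derivI[OF dP[OF that]])
  show "dir_deriv v h 0 = 0" by (rule dir_derivI[OF dN[OF N(2)]])
  have "continuous_on N (dir_deriv v h)"
    using dir_derivI[OF dN] by (simp cong: continuous_on_cong)
  moreover have "continuous_on punctured (dir_deriv v h)"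
  proof (subst continuous_on_cong[OF refl f])
    have "continuous_on UNIV \<psi>"
      using \<psi>(1) by (meson DERIV_isCont continuous_at_imp_continuous_on)
    then show "continuous_on punctured (\<lambda>x. \<psi>' (energy x) * dir_deriv v energy x * w x + \<psi> (energy x) * dir_deriv v w x)"
      using smooth_on_continuous[OF w] smooth_on_continuous[OF smooth_on_dir_deriv[OF w]]
        smooth_on_continuous[OF smooth_energy] smooth_on_continuous[OF smooth_on_dir_deriv[OF smooth_energy]]
      by (intro continuous_intros) (auto intro: continuous_on_compose2[OF \<psi>(2)] continuous_on_compose2[of UNIV \<psi>])
  qed auto
  ultimately have "continuous_on (N \<union> punctured) (dir_deriv v h)"
    by (intro continuous_on_open_Un N open_punctured)
  moreover have "N \<union> punctured = UNIV" using N(2) by auto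
  ultimately show "continuous_on UNIV (dir_deriv v h)" by simp
  obtain m where m: "m > 0" "\<And>x. energy x \<ge> m * (norm x)\<^sup>2" using energy_coercive by blast
  show "\<exists>R. \<forall>x. norm x > R \<longrightarrow> h x = 0"
  proof (intro exI allI impI)
    \<comment> \<open>The radius comes from coercivity: beyond it the energy is at least c.\<close>
    fix x :: 'a assume x: "norm x > sqrt (c / m)"
    have "c / m = (sqrt (c / m))\<^sup>2" using c(1) m(1) by simp
    also have "\<dots> \<le> (norm x)\<^sup>2" using x c(1) m(1) by (intro power_mono) auto
    finally have "c \<le> m * (norm x)\<^sup>2" using m(1) by (simp add: field_simps)
    then show "h x = 0" using m(2)[of x] c(2) by (simp add: h_def)
  qed
qed

text \<open>By Euler's relation the inverse metric maps the differential of the energy to the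
  position vector x. Contracting the Hessian of u with x then gives 0, because the first derivatives
  of u are 0-homogeneous.\<close>

lemma energy_pd_flux:
  assumes u: "smooth_on punctured u" and hom: "\<And>y t. y \<noteq> 0 \<Longrightarrow> t > 0 \<Longrightarrow> u (t *\<^sub>R y) = t * u y"
    and x: "x \<noteq> 0"
  shows "(\<Sum>i\<in>UNIV. pd i energy x * flux u i x) = 0"
proof -
  obtain c where c: "x = (\<Sum>i\<in>UNIV. c i *\<^sub>R b i)" using vector_basis_coords[OF basis] by blast
  have dif: "h differentiable at x" if "smooth_on punctured h" for h :: "'a \<Rightarrow> real"
    using smooth_on_differentiable[OF that] x by simp
  have e: "pd i energy x = (\<Sum>k\<in>UNIV. c k * metric x $ k $ i)" for i
  proof -
    have "pd i energy x = dir_deriv (\<Sum>k\<in>UNIV. c k *\<^sub>R b k) (pd i energy) x"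
      using energy_deriv_euler[OF x] c by simp
    also have "\<dots> = (\<Sum>k\<in>UNIV. c k * metric x $ k $ i)"
      by (subst dir_deriv_coords) (auto simp: metric_def intro!: dif smooth_intros)
    finally show ?thesis .
  qed
  have z: "(\<Sum>a\<in>UNIV. c a * pd a (pd k u) x) = 0" for k
  proof -
    have "pd k u (t *\<^sub>R x) = t ^ 0 * pd k u x" if "t > 0" for t
      by (rule dir_deriv_homogeneous) (use u x that hom in auto)
    then have "dir_deriv x (pd k u) x = 0"
      using dir_deriv_euler[of "pd k u" x 0] dif[OF smooth_on_dir_deriv[OF u]] by simp
    moreover have "dir_deriv x (pd k u) x = dir_deriv (\<Sum>k\<in>UNIV. c k *\<^sub>R b k) (pd k u) x"
      using c by simp
    ultimately show ?thesis
      by (simp add: dir_deriv_coords[OF dif[OF smooth_on_dir_deriv[OF u]]])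
  qed
  have "(\<Sum>i\<in>UNIV. pd i energy x * cometric x $ i $ a) = c a" for a
  proof -
    have "(\<Sum>i\<in>UNIV. pd i energy x * cometric x $ i $ a)
        = (\<Sum>k\<in>UNIV. c k * (metric x ** cometric x) $ k $ a)"
      unfolding e sum_distrib_right by (subst sum.swap) (simp add: matrix_matrix_mult_def sum_distrib_left mult.assoc)
    then show ?thesis using x by (simp add: metric_cometric mat_def if_distrib cong: if_cong)
  qed
  note 1 = this
  have "(\<Sum>i\<in>UNIV. pd i energy x * flux u i x)
      = (\<Sum>i\<in>UNIV. \<Sum>a\<in>UNIV. det (metric x) * (pd i energy x * cometric x $ i $ a) * hess_grad u a x)"
    by (simp add: flux_def sum_distrib_left ac_simps)
  also have "\<dots> = (\<Sum>a\<in>UNIV. det (metric x) * (\<Sum>i\<in>UNIV. pd i energy x * cometric x $ i $ a) * hess_grad u a x)"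
    by (subst sum.swap) (simp add: sum_distrib_left sum_distrib_right)
  also have "\<dots> = det (metric x) * (\<Sum>a\<in>UNIV. \<Sum>k\<in>UNIV. c a * pd a (pd k u) x * grad u k x)"
    unfolding 1 by (simp add: hess_grad_def sum_distrib_left ac_simps)
  also have "\<dots> = det (metric x) * (\<Sum>k\<in>UNIV. (\<Sum>a\<in>UNIV. c a * pd a (pd k u) x) * grad u k x)"
    by (subst sum.swap) (simp add: sum_distrib_right)
  finally show ?thesis by (simp add: z)
qed

theorem harmonic_homogeneous_hessian_zero:
  assumes u: "smooth_on punctured u" and hom: "\<And>y t. y \<noteq> 0 \<Longrightarrow> t > 0 \<Longrightarrow> u (t *\<^sub>R y) = t * u y"
    and har: "harmonic u" and x: "x \<noteq> 0"
  shows "pd i (pd j u) x = 0"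
proof -
  \<comment> \<open>The bump is positive at the energy of the given point x, so that the vanishing
    of q at x will force Q to vanish there.\<close>
  obtain \<psi> \<psi>' a c where \<psi>: "\<And>r. (\<psi> has_real_derivative \<psi>' r) (at r)" "continuous_on UNIV \<psi>'"
    and a: "0 < a" "\<forall>r\<le>a. \<psi> r = 0"
    and c: "0 < c" "\<forall>r\<ge>c. \<psi> r = 0"
    and pos: "\<And>r. \<psi> r \<ge> 0" "\<psi> (energy x) > 0"
    using C1_bump_exists[OF energy_pos[OF x]] by metis
  define h where "h i x = \<psi> (energy x) * flux u i x" for i x
  note cut = cutoff_properties[OF \<psi> a c smooth_flux[OF u], folded h_def]
  define Q where "Q y = (\<Sum>i\<in>UNIV. \<Sum>a\<in>UNIV. \<Sum>k\<in>UNIV. \<Sum>j\<in>UNIV.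
      cometric y $ i $ a * cometric y $ k $ j * ((\<chi> a k. pd a (pd k u) y) $ a $ k * (\<chi> a k. pd a (pd k u) y) $ i $ j))" for y
  have contr: "Q y \<ge> 0" "Q y = 0 \<Longrightarrow> (\<chi> a k. pd a (pd k u) y) = (0 :: real^'n^'n)" if "y \<noteq> 0" for y
    unfolding Q_def by (fact posdef_contraction_nonneg[OF metric_posdef[OF that] metric_cometric(1)[OF that]])+
  define q where "q y = (\<Sum>i\<in>UNIV. pd i (h i) y)" for y
  \<comment> \<open>The derivative of the cutoff multiplies the contraction of \<open>flux\<close>
    with the differential of the energy, which is 0; what remains has a sign.\<close>
  have q: "q y = \<psi> (energy y) * (det (metric y) * Q y)" if "y \<noteq> 0" for y
  proof -
    have "q y = \<psi>' (energy y) * (\<Sum>i\<in>UNIV. pd i energy y * flux u i y) + \<psi> (energy y) * (\<Sum>i\<in>UNIV. pd i (flux u i) y)"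
      by (simp add: q_def cut(2)[OF that] sum.distrib sum_distrib_left mult.assoc)
    then show ?thesis
      using energy_pd_flux[OF u hom that] flux_divergence[OF u har that] by (simp add: Q_def)
  qed
  have nonneg: "q y \<ge> 0" for y
  proof (cases "y = 0")
    case True
    then show ?thesis by (simp add: q_def cut(3))
  next
    case False
    then show ?thesis
      using pos(1)[of "energy y"] contr(1)[OF False] metric_det_pos[OF False] by (simp add: q)
  qed
  have cont: "continuous_on UNIV q" unfolding q_def by (intro continuous_intros cut(4))
  have int: "integrable lborel (pd i (h i))" "integral\<^sup>L lborel (pd i (h i)) = 0" for i
  proof -
    obtain R where R: "\<And>x. norm x > R \<Longrightarrow> h i x = 0" using cut(5)[of i] by auto
    show "integrable lborel (pd i (h i))"
      by (rule integral_dir_deriv_eq_0(1)[OF cut(1) cut(4)]) (rule R)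
    show "integral\<^sup>L lborel (pd i (h i)) = 0"
      by (rule integral_dir_deriv_eq_0(2)[OF cut(1) cut(4)]) (rule R)
  qed
  have int_q: "integrable lborel q" "integral\<^sup>L lborel q = 0"
    unfolding q_def using int by (auto simp: Bochner_Integration.integral_sum)
  have "q x = 0" by (rule continuous_nonneg_integral_eq_0[OF cont nonneg int_q])
  then have "Q x = 0" using q[OF x] pos(2) metric_det_pos[OF x] by simp
  then have "(\<chi> a k. pd a (pd k u) x) = (0 :: real^'n^'n)" by (rule contr(2)[OF x])
  then show ?thesis by (simp add: vec_eq_iff)
qed

end

subsection \<open>Isometries of Minkowski spaces\<close>

lemma vector_basis_image:
  assumes "linear L" "bij L" "vector_basis b"
  shows "vector_basis (\<lambda>i. L (b i))"
proof -
  have r: "range (\<lambda>i. L (b i)) = L ` range b" by auto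
  have "inj (\<lambda>i. L (b i))"
    using assms by (auto simp: vector_basis_def inj_def bij_def)
  moreover have "independent (L ` range b)"
    using assms by (intro linear_independent_injective_image) (auto simp: vector_basis_def bij_def)
  moreover have "span (L ` range b) = UNIV"
    using assms by (simp add: linear_span_image vector_basis_def bij_def)
  ultimately show ?thesis by (simp add: vector_basis_def r)
qed

text \<open>The logarithm turns the constant factor between the two volume ratios into an additive
  constant. The lemma allows the target to be described in the basis transported from the source,
  instead of the given \<open>b2\<close>.\<close>

lemma cartan_form_basis_independent:
  fixes F :: "'a::euclidean_space \<Rightarrow> real" and b b' :: "'n::finite \<Rightarrow> 'a"
  assumes "minkowski_space F" "vector_basis b" "vector_basis b'" "x \<noteq> 0"
  shows "cartan_form b F x = cartan_form b' F x"
proof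
  fix v
  interpret M: minkowski_frame F b by unfold_locales fact+
  interpret M': minkowski_frame F b' by unfold_locales fact+
  have "\<exists>c. b' i = (\<Sum>a\<in>UNIV. c a *\<^sub>R b a)" for i
    using vector_basis_coords[OF assms(2)] by metis
  then obtain c where c: "\<And>i. b' i = (\<Sum>a\<in>UNIV. c i a *\<^sub>R b a)" by metis
  define P :: "real^'n^'n" where "P = (\<chi> i a. c i a)"
  have det: "det (M'.metric y) = (det P)\<^sup>2 * det (M.metric y)" if "y \<noteq> 0" for y
  proof -
    have y: "y \<in> punctured" using that by simp
    have "M'.metric y $ i $ j = (P ** M.metric y ** transpose P) $ i $ j" for i j
    proof -
      have "M'.metric y $ i $ j = (\<Sum>l\<in>UNIV. \<Sum>k\<in>UNIV. c j l * (c i k * M.metric y $ k $ l))"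
        unfolding M'.metric_def vec_lambda_beta c
        using smooth_on_differentiable[OF smooth_on_dir_deriv[OF M.smooth_energy] y]
        by (simp add: dir_deriv_coords dir_deriv_coords2[OF open_punctured M.smooth_energy y]
            sum_distrib_left M.metric_def mult.left_commute)
      also have "\<dots> = (P ** M.metric y ** transpose P) $ i $ j"
        by (simp add: matrix_matrix_mult_def P_def transpose_def sum_distrib_left sum_distrib_right ac_simps)
      finally show ?thesis .
    qed
    then have "M'.metric y = P ** M.metric y ** transpose P" by (simp add: vec_eq_iff)
    then show ?thesis by (simp add: det_mul power2_eq_square)
  qed
  have P0: "det P \<noteq> 0" using det[OF assms(4)] M'.metric_det_pos[OF assms(4)] by auto
  have "dir_deriv v (\<lambda>y. ln (volume_ratio b' F y)) x = dir_deriv v (\<lambda>y. ln \<bar>det P\<bar> + ln (volume_ratio b F y)) x"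
  proof (rule dir_deriv_cong_open[OF open_punctured])
    fix y :: 'a assume "y \<in> punctured"
    then have y: "y \<noteq> 0" by simp
    show "ln (volume_ratio b' F y) = ln \<bar>det P\<bar> + ln (volume_ratio b F y)"
      using P0 M.metric_det_pos[OF y] det[OF y]
      by (simp add: M.volume_ratio_metric M'.volume_ratio_metric real_sqrt_mult ln_mult)
  qed (use assms in auto)
  also have "\<dots> = dir_deriv v (\<lambda>y. ln (volume_ratio b F y)) x"
    using M.ln_volume_ratio_has_derivative[OF assms(4)]
    by (subst dir_deriv_add) (auto simp: differentiable_def dir_deriv_def)
  finally show "cartan_form b F x v = cartan_form b' F x v"
    by (simp add: cartan_form_def dir_deriv_def)
qed

lemma dir_deriv_compose:
  assumes "f differentiable at x" "h differentiable at (f x)"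
  shows "dir_deriv v (\<lambda>y. h (f y)) x = dir_deriv (dir_deriv v f x) h (f x)"
  by (rule dir_derivI) (rule has_derivative_compose[OF has_derivative_dir_deriv[OF assms(1)] has_derivative_dir_deriv[OF assms(2)]])

lemma dir_deriv_linear: "linear L \<Longrightarrow> dir_deriv v L x = L v"
  by (rule dir_derivI) (simp add: linear_imp_has_derivative)

text \<open>Product and chain rule for the Hessian of h evaluated on two vector fields along f: one
  term for each field and one for the moving base point.\<close>

lemma dir_deriv_hessian_along:
  fixes f V W :: "'a::euclidean_space \<Rightarrow> 'b::euclidean_space" and h :: "'b \<Rightarrow> real"
  assumes S: "open S" "x \<in> S" "\<And>y. y \<in> S \<Longrightarrow> f y \<in> T" and T: "open T" "smooth_on T h"
    and d: "f differentiable at x" "V differentiable at x" "W differentiable at x"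
  shows "dir_deriv k (\<lambda>y. dir_deriv (V y) (dir_deriv (W y) h) (f y)) x =
      dir_deriv (dir_deriv k V x) (dir_deriv (W x) h) (f x)
    + dir_deriv (V x) (dir_deriv (dir_deriv k W x) h) (f x)
    + dir_deriv (dir_deriv k f x) (dir_deriv (V x) (dir_deriv (W x) h)) (f x)"
proof -
  define A where "A e e' = dir_deriv e (dir_deriv e' h)" for e e'
  have A: "smooth_on T (A e e')" for e e' unfolding A_def by (intro smooth_on_dir_deriv T)
  \<comment> \<open>In a fixed basis the varying directions become scalar coefficients, separated
    from the fixed functions \<open>A e e'\<close>.\<close>
  have expand: "dir_deriv v (dir_deriv w h) z = (\<Sum>e\<in>Basis. \<Sum>e'\<in>Basis. (v \<bullet> e) * (w \<bullet> e') * A e e' z)"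
    if "z \<in> T" for v w z
  proof -
    have "dir_deriv v (dir_deriv w h) z
        = dir_deriv (\<Sum>e\<in>Basis. (v \<bullet> e) *\<^sub>R e) (dir_deriv (\<Sum>e'\<in>Basis. (w \<bullet> e') *\<^sub>R e') h) z"
      by (simp add: euclidean_representation)
    also have "\<dots> = (\<Sum>e\<in>Basis. \<Sum>e'\<in>Basis. (v \<bullet> e) * (w \<bullet> e') * A e e' z)"
      by (subst dir_deriv_coords[OF smooth_on_differentiable[OF smooth_on_dir_deriv[OF T(2)] that]])
         (simp add: dir_deriv_coords2[OF T that] A_def sum_distrib_left mult.assoc)
    finally show ?thesis .
  qed
  have fx: "f x \<in> T" using S by blast
  have "dir_deriv k (\<lambda>y. dir_deriv (V y) (dir_deriv (W y) h) (f y)) x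
      = dir_deriv k (\<lambda>y. \<Sum>e\<in>Basis. \<Sum>e'\<in>Basis. (V y \<bullet> e) * (W y \<bullet> e') * A e e' (f y)) x"
    by (rule dir_deriv_cong_open[OF S(1,2)]) (simp add: expand S)
  also have "\<dots> = (\<Sum>e\<in>Basis. \<Sum>e'\<in>Basis. (V x \<bullet> e) * (W x \<bullet> e') * dir_deriv (dir_deriv k f x) (A e e') (f x)
      + ((V x \<bullet> e) * (dir_deriv k W x \<bullet> e') + (dir_deriv k V x \<bullet> e) * (W x \<bullet> e')) * A e e' (f x))"
  proof (rule dir_derivI, intro has_derivative_sum has_derivative_mult)
    show "((\<lambda>y. V y \<bullet> e) has_derivative (\<lambda>k. dir_deriv k V x \<bullet> e)) (at x)" for e
      by (intro has_derivative_inner_left has_derivative_dir_deriv d)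
    show "((\<lambda>y. W y \<bullet> e) has_derivative (\<lambda>k. dir_deriv k W x \<bullet> e)) (at x)" for e
      by (intro has_derivative_inner_left has_derivative_dir_deriv d)
    show "((\<lambda>y. A e e' (f y)) has_derivative (\<lambda>k. dir_deriv (dir_deriv k f x) (A e e') (f x))) (at x)" for e e'
      by (rule has_derivative_compose[OF has_derivative_dir_deriv[OF d(1)] smooth_on_has_derivative[OF A fx]])
  qed
  also have "\<dots> = dir_deriv (dir_deriv k V x) (dir_deriv (W x) h) (f x)
    + dir_deriv (V x) (dir_deriv (dir_deriv k W x) h) (f x)
    + (\<Sum>e\<in>Basis. \<Sum>e'\<in>Basis. (V x \<bullet> e) * (W x \<bullet> e') * dir_deriv (dir_deriv k f x) (A e e') (f x))"
    by (simp add: expand[OF fx] sum.distrib distrib_right)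
  also have "(\<Sum>e\<in>Basis. \<Sum>e'\<in>Basis. (V x \<bullet> e) * (W x \<bullet> e') * dir_deriv (dir_deriv k f x) (A e e') (f x))
      = dir_deriv (dir_deriv k f x) (\<lambda>z. \<Sum>e\<in>Basis. \<Sum>e'\<in>Basis. (V x \<bullet> e) * (W x \<bullet> e') * A e e' z) (f x)"
    by (rule dir_derivI[symmetric], intro has_derivative_sum has_derivative_mult_right smooth_on_has_derivative[OF A fx])
  also have "\<dots> = dir_deriv (dir_deriv k f x) (dir_deriv (V x) (dir_deriv (W x) h)) (f x)"
    by (rule dir_deriv_cong_open[OF T(1) fx]) (simp add: expand)
  finally show ?thesis .
qed

section \<open>Linear isometries pull back both tensors\<close>

lemma linear_isometry_pullbacks:
  fixes F1 :: "'a::euclidean_space \<Rightarrow> real" and F2 :: "'b::euclidean_space \<Rightarrow> real"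
    and b1 :: "'n::finite \<Rightarrow> 'a" and b2 :: "'n \<Rightarrow> 'b"
  assumes M: "minkowski_space F1" "minkowski_space F2" "vector_basis b1" "vector_basis b2"
    and L: "linear L" "bij L" "F1 = F2 \<circ> L" and x: "x \<noteq> 0"
  shows "conformal_tensor F1 x = pullback_tensor L (conformal_tensor F2) x"
    and "cartan_form b1 F1 x = pullback_form L (cartan_form b2 F2) x"
proof -
  \<comment> \<open>In the transported basis the matrices of the two fundamental tensors at y and
    \<open>L y\<close> agree entry by entry, so the volume ratios correspond without a
    constant.\<close>
  define b' where "b' i = L (b1 i)" for i
  have b': "vector_basis b'" unfolding b'_def[abs_def] by (rule vector_basis_image[OF L(1,2) M(3)])
  interpret M1: minkowski_frame F1 b1 by unfold_locales fact+
  interpret M2: minkowski_frame F2 b' by unfold_locales fact+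
  have L0: "L y \<noteq> 0" if "y \<noteq> 0" for y
    using that L(1,2) by (metis bij_def injD linear_0)
  have Ld: "L differentiable at y" for y
    using L(1) linear_imp_differentiable by blast
  have comp: "dir_deriv v (\<lambda>y. h (L y)) y = dir_deriv (L v) h (L y)" if "smooth_on punctured h" "y \<noteq> 0" for h :: "'b \<Rightarrow> real" and v y
    using dir_deriv_compose[OF Ld, of h y v] smooth_on_differentiable[OF that(1)] L0[OF that(2)]
    by (simp add: dir_deriv_linear[OF L(1)])
  have e: "M1.energy = (\<lambda>y. M2.energy (L y))"
    unfolding M1.energy_def[abs_def] M2.energy_def[abs_def] by (simp add: L(3))
  have tensor: "fundamental_tensor F1 y u v = fundamental_tensor F2 (L y) (L u) (L v)" if "y \<noteq> 0" for y u v
  proof -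
    have "dir_deriv u (dir_deriv v M1.energy) y = dir_deriv u (\<lambda>y. dir_deriv (L v) M2.energy (L y)) y"
      unfolding e by (rule dir_deriv_cong_open[OF open_punctured])
        (use that in \<open>auto intro: comp M2.smooth_energy\<close>)
    also have "\<dots> = dir_deriv (L u) (dir_deriv (L v) M2.energy) (L y)"
      by (intro comp smooth_on_dir_deriv M2.smooth_energy that)
    finally show ?thesis by (simp add: M1.fundamental_tensor_energy M2.fundamental_tensor_energy)
  qed
  have fd: "frechet_derivative L (at y) = L" for y
    using dir_deriv_linear[OF L(1)] by (auto simp: dir_deriv_def)
  show "conformal_tensor F1 x = pullback_tensor L (conformal_tensor F2) x"
    using fun_cong[OF L(3), of x] by (simp add: fun_eq_iff conformal_tensor_def pullback_tensor_def fd tensor[OF x])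
  have "dir_deriv v (\<lambda>y. ln (volume_ratio b1 F1 y)) x = dir_deriv v (\<lambda>y. ln (volume_ratio b' F2 (L y))) x" for v
    by (rule dir_deriv_cong_open[OF open_punctured]) (use x in \<open>auto simp: volume_ratio_def tensor b'_def\<close>)
  also have "dir_deriv v (\<lambda>y. ln (volume_ratio b' F2 (L y))) x = dir_deriv (L v) (\<lambda>y. ln (volume_ratio b' F2 y)) (L x)" for v
    using dir_deriv_compose[OF Ld, of "\<lambda>y. ln (volume_ratio b' F2 y)" x v] M2.ln_volume_ratio_has_derivative[OF L0[OF x]]
    by (auto simp: differentiable_def dir_deriv_linear[OF L(1)])
  finally have "cartan_form b1 F1 x v = cartan_form b' F2 (L x) (L v)" for v
    by (simp add: cartan_form_def dir_deriv_def)
  then show "cartan_form b1 F1 x = pullback_form L (cartan_form b2 F2) x"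
    by (simp add: fun_eq_iff pullback_form_def fd cartan_form_basis_independent[OF M(2) b' M(4) L0[OF x]])
qed

section \<open>Maps that respect the conformal tensor and the Cartan form\<close>

locale homogeneous_isometry =
  M1: minkowski_frame F1 b1 + M2: minkowski_frame F2 b2
  for F1 :: "'a::euclidean_space \<Rightarrow> real" and F2 :: "'b::euclidean_space \<Rightarrow> real"
    and b1 :: "'n::finite \<Rightarrow> 'a" and b2 :: "'n \<Rightarrow> 'b" +
  fixes f :: "'a \<Rightarrow> 'b"
  assumes norm_preserving: "F2 (f v) = F1 v"
    and diffeo: "diffeomorphism_between punctured punctured f"
    and homogeneous: "t > 0 \<Longrightarrow> f (t *\<^sub>R v) = t *\<^sub>R f v"
    and tensor_pullback: "x \<noteq> 0 \<Longrightarrow> conformal_tensor F1 x = pullback_tensor f (conformal_tensor F2) x"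
    and cartan_pullback: "x \<noteq> 0 \<Longrightarrow> cartan_form b1 F1 x = pullback_form f (cartan_form b2 F2) x"
begin

lemma smooth_map: "smooth_on punctured f"
  using diffeo by (auto simp: diffeomorphism_between_def)

lemma map_differentiable: "x \<noteq> 0 \<Longrightarrow> f differentiable at x"
  using smooth_on_differentiable[OF smooth_map] by simp

lemma map_punctured: "x \<noteq> 0 \<Longrightarrow> f x \<noteq> 0"
  using M1.norm_pos[of x] norm_preserving[of x] M2.norm_zero by auto

lemma map_zero: "f 0 = 0"
  using M2.norm_pos[of "f 0"] norm_preserving[of 0] M1.norm_zero by auto

lemma map_bij: "bij f"
proof -
  obtain g where g: "homeomorphism punctured punctured f g"
    using diffeo by (auto simp: diffeomorphism_between_def)
  have "inj f"
  proof (rule injI)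
    fix x y assume "f x = f y"
    then show "x = y"
      using g map_punctured map_zero unfolding homeomorphism_def
      by (metis ComplI singletonD)
  qed
  moreover have "y \<in> range f" for y
    using g map_zero unfolding homeomorphism_def by (cases "y = 0") (metis rangeI, blast)
  ultimately show ?thesis by (auto simp: bij_def)
qed

text \<open>The derivative of the inverse diffeomorphism is a two-sided inverse. Consequently the
  derivative of f at x carries the basis \<open>b1\<close> to a basis of the target.\<close>

lemma bij_map_deriv:
  assumes "x \<noteq> 0"
  shows "bij (\<lambda>v. dir_deriv v f x)"
proof -
  obtain g where g: "homeomorphism punctured punctured f g" "smooth_on punctured g"
    using diffeo by (auto simp: diffeomorphism_between_def)
  have inv: "g (f y) = y" "f (g z) = z" if "y \<noteq> 0" "z \<noteq> 0" for y z
    using g(1) that by (auto simp: homeomorphism_def)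
  have gd: "g differentiable at (f x)"
    using smooth_on_differentiable[OF g(2)] map_punctured[OF assms] by simp
  have "dir_deriv (dir_deriv v f x) g (f x) = v" for v
  proof -
    have "dir_deriv (dir_deriv v f x) g (f x) = dir_deriv v (\<lambda>y. g (f y)) x"
      by (rule dir_deriv_compose[symmetric]) (use gd map_differentiable assms in auto)
    also have "\<dots> = dir_deriv v (\<lambda>y. y) x"
      by (rule dir_deriv_cong_open[OF open_punctured]) (use assms inv in auto)
    finally show ?thesis by (simp add: dir_deriv_def)
  qed
  moreover have "dir_deriv (dir_deriv w g (f x)) f x = w" for w
  proof -
    have "dir_deriv (dir_deriv w g (f x)) f x = dir_deriv w (\<lambda>z. f (g z)) (f x)"
      using dir_deriv_compose[OF gd, of f w] map_differentiable[OF assms] inv(1)[OF assms map_punctured[OF assms]] by simp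
    also have "\<dots> = dir_deriv w (\<lambda>z. z) (f x)"
      by (rule dir_deriv_cong_open[OF open_punctured]) (use assms map_punctured inv in auto)
    finally show ?thesis by (simp add: dir_deriv_def)
  qed
  ultimately show ?thesis by (intro bij_betw_byWitness[where f'="\<lambda>w. dir_deriv w g (f x)"]) auto
qed

lemma tensor_isometry:
  assumes "x \<noteq> 0"
  shows "fundamental_tensor F1 x u v = fundamental_tensor F2 (f x) (dir_deriv u f x) (dir_deriv v f x)"
  using fun_cong[OF fun_cong[OF tensor_pullback[OF assms], of u], of v] M1.norm_pos[OF assms]
  by (simp add: conformal_tensor_def pullback_tensor_def norm_preserving dir_deriv_def)

lemma smooth_component: "smooth_on punctured (\<lambda>y. f y \<bullet> e)"
  by (rule smooth_on_bounded_linear[OF open_punctured bounded_linear_inner_left smooth_map])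

lemma component_deriv2:
  assumes "x \<noteq> 0"
  shows "dir_deriv u (dir_deriv v (\<lambda>y. f y \<bullet> e)) x = dir_deriv u (dir_deriv v f) x \<bullet> e"
proof -
  have "dir_deriv u (dir_deriv v (\<lambda>y. f y \<bullet> e)) x = dir_deriv u (\<lambda>y. dir_deriv v f y \<bullet> e) x"
    by (rule dir_deriv_cong_open[OF open_punctured])
       (use assms in \<open>auto intro!: dir_deriv_bounded_linear bounded_linear_inner_left map_differentiable\<close>)
  also have "\<dots> = dir_deriv u (dir_deriv v f) x \<bullet> e"
    by (intro dir_deriv_bounded_linear bounded_linear_inner_left smooth_on_differentiable[of punctured])
       (use assms in \<open>auto intro: smooth_on_dir_deriv smooth_map\<close>)
  finally show ?thesis .
qed

lemma map_deriv_commute: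
  assumes "x \<noteq> 0"
  shows "dir_deriv u (dir_deriv v f) x = dir_deriv v (dir_deriv u f) x"
proof (rule euclidean_eqI)
  fix e :: 'b
  show "dir_deriv u (dir_deriv v f) x \<bullet> e = dir_deriv v (dir_deriv u f) x \<bullet> e"
    unfolding component_deriv2[OF assms, symmetric]
    by (rule dir_deriv_commute[OF open_punctured smooth_component]) (use assms in simp)
qed

text \<open>In the basis transported by the derivative of f at x, the isometry makes the metrics at
  x and \<open>f x\<close> equal, and hence their inverses. The third derivatives of the two
  energies then differ by second derivatives of f, and the Cartan forms compare their
  traces.\<close>

lemma component_harmonic: "M1.harmonic (\<lambda>y. f y \<bullet> e)"
  unfolding M1.harmonic_def
proof (intro allI impI)
  fix x :: 'a assume x: "x \<noteq> 0"
  \<comment> \<open>The basis is frozen at x: \<open>M'\<close> works with constant fields, and the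
    variation of the derivative of f enters only through \<open>ff\<close>.\<close>
  define b' where "b' i = dir_deriv (b1 i) f x" for i
  have "vector_basis b'"
    unfolding b'_def[abs_def]
    by (rule vector_basis_image[OF linear_dir_deriv[OF map_differentiable[OF x]] bij_map_deriv[OF x] M1.basis])
  then interpret M': minkowski_frame F2 b' by unfold_locales (rule M2.minkowski)
  note fx = map_punctured[OF x]
  define ff where "ff i j = dir_deriv (b1 i) (dir_deriv (b1 j) f) x" for i j
  have ff_sym: "ff i j = ff j i" for i j unfolding ff_def by (rule map_deriv_commute[OF x])
  define B where "B = fundamental_tensor F2 (f x)"
  have B_sym: "B u v = B v u" for u v
    unfolding B_def M2.fundamental_tensor_energy
    by (rule dir_deriv_commute[OF open_punctured M2.smooth_energy]) (use fx in simp)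
  have B_lin: "linear (\<lambda>u. B u v)" for v
    unfolding B_def M2.fundamental_tensor_energy
    by (intro linear_dir_deriv smooth_on_differentiable[of punctured] smooth_on_dir_deriv M2.smooth_energy) (use fx in simp)
  have metric: "M'.metric (f x) = M1.metric x"
    using tensor_isometry[OF x]
    by (simp add: vec_eq_iff M'.metric_def M1.metric_def b'_def
        M1.fundamental_tensor_energy M2.fundamental_tensor_energy)
  then have cometric: "M'.cometric (f x) = M1.cometric x" by (simp add: M'.cometric_def M1.cometric_def)
  let ?H = "M1.cometric x"
  have third: "M1.third i j k x = B (ff k i) (b' j) + B (ff k j) (b' i) + M'.third i j k (f x)" for i j k
  proof -
    have "M1.third i j k x = dir_deriv (b1 k) (\<lambda>y. fundamental_tensor F1 y (b1 i) (b1 j)) x"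
      by (simp add: M1.third_def M1.fundamental_tensor_energy)
    also have "\<dots> = dir_deriv (b1 k) (\<lambda>y. dir_deriv (dir_deriv (b1 i) f y) (dir_deriv (dir_deriv (b1 j) f y) M2.energy) (f y)) x"
      by (rule dir_deriv_cong_open[OF open_punctured])
         (use x in \<open>auto simp: tensor_isometry M2.fundamental_tensor_energy\<close>)
    also have "\<dots> = B (ff k i) (b' j) + B (b' i) (ff k j) + M'.third i j k (f x)"
      unfolding B_def M2.fundamental_tensor_energy M'.third_def b'_def ff_def
      by (rule dir_deriv_hessian_along[OF open_punctured _ _ open_punctured M2.smooth_energy])
         (use x in \<open>auto intro!: map_punctured map_differentiable smooth_on_differentiable[of punctured] smooth_on_dir_deriv smooth_map\<close>)
    finally show ?thesis by (simp add: B_sym[of "b' i"])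
  qed
  \<comment> \<open>the permutation argument that determines the Christoffel symbols\<close>
  have S: "B (ff k i) (b' j) = B (ff i j) (b' k)" for i j k
    using third[of i j k] third[of i k j] M1.third_swap23[OF x, of i j k] M'.third_swap23[OF fx, of i j k]
    by (simp add: ff_sym[of k j] ff_sym[of j i])
  \<comment> \<open>By \<open>S\<close> the two correction terms in \<open>third\<close> coincide,
    whence the factor 2.\<close>
  have third': "M1.third q p k x = 2 * B (ff p q) (b' k) + M'.third q p k (f x)" for p q k
    using third[of q p k] S[of k q p] S[of k p q] by (simp add: ff_sym[of q p])
  \<comment> \<open>The trace of the second derivative of f. Equality of the Cartan forms makes it
    B-orthogonal to every vector of \<open>b'\<close>, hence to itself.\<close>
  define v where "v = (\<Sum>p\<in>UNIV. \<Sum>q\<in>UNIV. ?H $ p $ q *\<^sub>R ff p q)"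
  have "B v (b' k) = 0" for k
  proof -
    have "cartan_form b1 F1 x (b1 k) = cartan_form b' F2 (f x) (b' k)"
      using fun_cong[OF cartan_pullback[OF x], of "b1 k"]
        cartan_form_basis_independent[OF M2.minkowski M2.basis M'.basis fx]
      by (simp add: pullback_form_def b'_def dir_deriv_def)
    then have "(\<Sum>p\<in>UNIV. \<Sum>q\<in>UNIV. ?H $ p $ q * M1.third q p k x) = (\<Sum>p\<in>UNIV. \<Sum>q\<in>UNIV. ?H $ p $ q * M'.third q p k (f x))"
      by (simp add: M1.cartan_form_pd[OF x] M'.cartan_form_pd[OF fx] cometric)
    then have "(\<Sum>p\<in>UNIV. \<Sum>q\<in>UNIV. ?H $ p $ q * (2 * B (ff p q) (b' k))) = 0"
      by (simp add: third' distrib_left sum.distrib)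
    then have "2 * (\<Sum>p\<in>UNIV. \<Sum>q\<in>UNIV. ?H $ p $ q * B (ff p q) (b' k)) = 0"
      by (simp only: mult.left_commute[of _ 2] sum_distrib_left[symmetric])
    then show ?thesis by (simp add: v_def linear_sum[OF B_lin] linear_scale[OF B_lin])
  qed
  then have B0: "B (b' k) v = 0" for k by (simp add: B_sym[of _ v])
  obtain c where c: "v = (\<Sum>i\<in>UNIV. c i *\<^sub>R b' i)" using vector_basis_coords[OF M'.basis] by blast
  have "B (\<Sum>i\<in>UNIV. c i *\<^sub>R b' i) v = 0"
    by (simp add: linear_sum[OF B_lin] linear_scale[OF B_lin] B0)
  then have "B v v = 0" using c by simp
  then have "v = 0" using M2.fundamental_tensor_pos[OF fx, of v] by (auto simp: B_def)
  then have "v \<bullet> e = 0" by simp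
  then show "(\<Sum>i\<in>UNIV. \<Sum>a\<in>UNIV. ?H $ i $ a * M1.pd i (M1.pd a (\<lambda>y. f y \<bullet> e)) x) = 0"
    by (simp add: v_def component_deriv2[OF x] ff_def inner_sum_left)
qed

theorem map_linear:
  assumes "DIM('a) \<ge> 2"
  shows "linear f"
proof -
  obtain z :: 'a where z: "z \<noteq> 0" by (metis UNIV_I all_not_in_conv nonempty_Basis nonzero_Basis)
  define u where "u e y = f y \<bullet> e" for e y
  have u: "smooth_on punctured (u e)" for e unfolding u_def by (rule smooth_component)
  have du: "u e differentiable at x" "M1.pd j (u e) differentiable at x" if "x \<noteq> 0" for e j x
    using smooth_on_differentiable[OF u] smooth_on_differentiable[OF smooth_on_dir_deriv[OF u]] that by auto
  have hom: "u e (t *\<^sub>R y) = t * u e y" if "t > 0" for e t y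
    using that by (simp add: u_def homogeneous)
  have hess: "M1.pd i (M1.pd j (u e)) x = 0" if "x \<noteq> 0" for i j e x
    using M1.harmonic_homogeneous_hessian_zero[OF u hom _ that] component_harmonic
    unfolding u_def[abs_def] by blast
  have const: "M1.pd j (u e) x = M1.pd j (u e) z" if "x \<noteq> 0" for j e x
  proof (rule has_derivative_zero_unique_connected[where f="M1.pd j (u e)", OF open_punctured])
    show "connected (punctured :: 'a set)" by (rule connected_punctured_universe[OF assms])
    fix y :: 'a assume "y \<in> punctured"
    then have y: "y \<noteq> 0" by simp
    have "dir_deriv v (M1.pd j (u e)) y = 0" for v
    proof -
      obtain c where "v = (\<Sum>i\<in>UNIV. c i *\<^sub>R b1 i)" using vector_basis_coords[OF M1.basis] by blast
      then show ?thesis by (simp add: dir_deriv_coords[OF du(2)[OF y]] hess[OF y])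
    qed
    moreover have "(M1.pd j (u e) has_derivative (\<lambda>v. dir_deriv v (M1.pd j (u e)) y)) (at y)"
      by (rule has_derivative_dir_deriv[OF du(2)[OF y]])
    ultimately show "(M1.pd j (u e) has_derivative (\<lambda>v. 0)) (at y)" by simp
  qed (use that z in auto)
  \<comment> \<open>Euler's relation expresses \<open>f x\<close> as the derivative of f at x
    applied to x; as the derivative is constant, it may be taken at z, which exhibits f as a linear
    map.\<close>
  have eq: "f x = dir_deriv x f z" for x
  proof (cases "x = 0")
    case True
    then show ?thesis
      using linear_0[OF linear_dir_deriv[OF map_differentiable[OF z]]] by (simp add: map_zero)
  next
    case False
    obtain c where c: "x = (\<Sum>i\<in>UNIV. c i *\<^sub>R b1 i)" using vector_basis_coords[OF M1.basis] by blast
    have coords: "dir_deriv x (u e) y = (\<Sum>i\<in>UNIV. c i * M1.pd i (u e) y)" if "y \<noteq> 0" for e y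
      unfolding c by (rule dir_deriv_coords[OF du(1)[OF that]])
    have "f x \<bullet> e = dir_deriv x f z \<bullet> e" for e
    proof -
      have "f x \<bullet> e = dir_deriv x (u e) x"
        using dir_deriv_euler[of "u e" x 1] du[OF False] hom by (simp add: u_def)
      also have "\<dots> = dir_deriv x (u e) z"
        by (simp add: coords[OF False] coords[OF z] const[OF False])
      also have "\<dots> = dir_deriv x f z \<bullet> e"
        unfolding u_def[abs_def]
        by (intro dir_deriv_bounded_linear bounded_linear_inner_left map_differentiable z)
      finally show ?thesis .
    qed
    then show ?thesis by (rule euclidean_eqI)
  qed
  have "f = (\<lambda>v. dir_deriv v f z)" by (rule ext) (rule eq)
  from arg_cong[OF this, of linear] linear_dir_deriv[OF map_differentiable[OF z]] show ?thesis by (rule iffD2)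
qed

end

theorem theorem1:
  fixes n :: nat
    and F1 :: "'a::euclidean_space \<Rightarrow> real" and F2 :: "'b::euclidean_space \<Rightarrow> real"
    and f :: "'a \<Rightarrow> 'b"
    and b1 :: "'n::finite \<Rightarrow> 'a" and b2 :: "'n \<Rightarrow> 'b"
  assumes "DIM('a) = n" and "DIM('b) = n" and "n > 2"
    and "minkowski_space F1" and "minkowski_space F2"
    and "vector_basis b1" and "vector_basis b2"
    and "\<And>v. F2 (f v) = F1 v"
    and "diffeomorphism_between punctured punctured f"
    and "\<And>v t. t > 0 \<Longrightarrow> f (t *\<^sub>R v) = t *\<^sub>R f v"
  shows "((\<forall>x\<in>punctured. conformal_tensor F1 x = pullback_tensor f (conformal_tensor F2) x) \<and>
          (\<forall>x\<in>punctured. cartan_form b1 F1 x = pullback_form f (cartan_form b2 F2) x))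
     \<longleftrightarrow> (\<exists>L. linear L \<and> bij L \<and> f = L \<and> F1 = F2 \<circ> L)"
proof
  assume eq: "(\<forall>x\<in>punctured. conformal_tensor F1 x = pullback_tensor f (conformal_tensor F2) x) \<and>
          (\<forall>x\<in>punctured. cartan_form b1 F1 x = pullback_form f (cartan_form b2 F2) x)"
  interpret homogeneous_isometry F1 F2 b1 b2 f
    by unfold_locales (use assms eq in auto)
  show "\<exists>L. linear L \<and> bij L \<and> f = L \<and> F1 = F2 \<circ> L"
    using map_linear map_bij assms(1,3,8) by (intro exI[of _ f]) (auto simp: fun_eq_iff)
next
  assume "\<exists>L. linear L \<and> bij L \<and> f = L \<and> F1 = F2 \<circ> L"
  then show "(\<forall>x\<in>punctured. conformal_tensor F1 x = pullback_tensor f (conformal_tensor F2) x) \<and>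
          (\<forall>x\<in>punctured. cartan_form b1 F1 x = pullback_form f (cartan_form b2 F2) x)"
    using linear_isometry_pullbacks[OF assms(4-7)] by auto
qed

end
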